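(* Let $d\geqslant 4$ be an integer and let $n$ be a positive integer with $n\equiv -1\pmod{d}$. Then \[ \sum_{k=0}^{n-1}[2dk+1]\frac{(q;q^d)_k^d}{(q^d;q^d)_k^d}q^{\frac{d(d-3)k}{2}} \equiv 0\pmod{\Phi_n(q)^2\Phi_{dn-n}(q)}. \]
   Context: $q$ is an indeterminate. The $q$-shifted factorial is $(a;q)_k=(1-a)(1-aq)\cdots(1-aq^{k-1})$ (with $(a;q)_0=1$). For any integer $m$, $[m]=(1-q^m)/(1-q)$. $\Phi_m(q)$ denotes the $m$-th cyclotomic polynomial. A congruence of rational functions modulo a polynomial $P(q)$, where the denominators are coprime to $P(q)$, means that $P(q)$ divides the numerator of the difference in lowest terms. *)

theory Defs
  imports Complex_Main "HOL-Computational_Algebra.Polynomial" "HOL-Computational_Algebra.Fraction_Field"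
begin

type_synonym ratfun = "complex poly fract"

definition qvar :: "complex poly" where
  "qvar = [:0, 1:]"

definition rf :: "complex poly \<Rightarrow> ratfun" where
  "rf p = Fract p 1"

definition qpoch :: "complex poly \<Rightarrow> complex poly \<Rightarrow> nat \<Rightarrow> complex poly" where
  "qpoch a b k = (\<Prod>i<k. 1 - a * b ^ i)"

definition qint :: "nat \<Rightarrow> ratfun" where
  "qint m = Fract (1 - qvar ^ m) (1 - qvar)"

definition cyclotomic :: "nat \<Rightarrow> complex poly" where
  "cyclotomic m = (\<Prod>k\<in>{k. 1 \<le> k \<and> k \<le> m \<and> coprime k m}.
                     [:- cis (2 * pi * real k / real m), 1:])"

text \<open>Congruence of rational functions modulo a polynomial P: the rational function
f - g can be written as A/B with B coprime to P and P dividing A (equivalently,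
P divides the numerator of f - g in lowest terms, the denominator being coprime to P).\<close>
definition rf_cong :: "ratfun \<Rightarrow> ratfun \<Rightarrow> complex poly \<Rightarrow> bool" where
  "rf_cong f g P \<longleftrightarrow> (\<exists>A B. B \<noteq> 0 \<and> coprime B P \<and> P dvd A \<and> f - g = Fract A B)"

end

theory Submission
  imports Defs "HOL-Library.Real_Mod" "HOL-Computational_Algebra.Polynomial_Factorial"
    "HOL-Computational_Algebra.Field_as_Ring"
begin

text \<open>
  Put Q = q^d, d m = n + 1 and N = n - m. Up to the factor 1/(1-q), the sum is
  S(q) = sum over k < n of (1 - q Q^(2k)) ((q;Q)_k / (Q;Q)_k)^d q^(d(d-3)k/2), and it must be shown that S
  vanishes at the primitive roots of unity of order (d-1)n and vanishes to second order at those of order n.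

  At a root of order (d-1)n one has q = Q^(-N), and the terms k and N - k cancel.

  At a root x of order n, one has q = Q^m = Q^(-N), and S may be replaced by anything with the same value and
  derivative. For odd d, (q;Q)_k^d agrees to first order with (Q^(-N);Q)_k (Q^m;Q)_k^(d-1). As
  (Q^m;Q)_k / (Q;Q)_k is a polynomial of degree m - 1 in Q^k, the modified sum applies the functional
  f \<mapsto> sum over k of (Q^(-N);Q)_k / (Q;Q)_k f(Q^k) to a combination of the monomials z^1, ..., z^N,
  and this functional kills them by the q-binomial theorem; this is where d > 3 is needed.

  For even d the exponents of z are half-integers. Here S is compared with a series T that is exactly antisymmetric
  under k \<mapsto> N - k, obtained from S by deforming the parameters by powers of q^n. To first order, T
  differs from S by an infinitesimal shift z \<mapsto> \<mu>z of the argument z = Q^k at q = x.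
  The sum over all k modulo n of the shifted summand filters out a single monomial in \<mu>,
  whose coefficient vanishes because S(x) = T(x) = 0.
\<close>

section \<open>Terminating q-series\<close>

text \<open>The \<open>q\<close>-shifted factorial (a;Q)_k over an arbitrary commutative ring, so
  that the same identities serve for polynomials and for complex numbers.\<close>

definition qfac :: "'a::comm_ring_1 \<Rightarrow> 'a \<Rightarrow> nat \<Rightarrow> 'a" where
  "qfac a Q k = (\<Prod>i<k. 1 - a * Q ^ i)"

lemma qfac_0 [simp]: "qfac a Q 0 = 1"
  by (simp add: qfac_def)

lemma qfac_Suc: "qfac a Q (Suc k) = qfac a Q k * (1 - a * Q ^ k)"
  by (simp add: qfac_def)

lemma qfac_add: "qfac a Q (j + k) = qfac a Q j * qfac (a * Q ^ j) Q k"
  by (induction k) (simp_all add: qfac_Suc power_add algebra_simps)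

lemma qfac_Suc_left: "qfac a Q (Suc k) = (1 - a) * qfac (a * Q) Q k"
  using qfac_add[of a Q 1 k] by (simp add: qfac_Suc)

lemma qfac_eq_0_iff: "qfac a Q k = 0 \<longleftrightarrow> (\<exists>i<k. a * Q ^ i = 1)" for a :: "'a::idom"
  by (auto simp: qfac_def)

text \<open>Both sides are ways to cut the product (uQ;Q)_(m-1+k) in two. The use is that (uQ^m;Q)_k
  / (uQ;Q)_k is, up to a factor free of \<open>k\<close>, a polynomial of degree at most m - 1 in
  uQ^k.\<close>

lemma qfac_shift:
  assumes "m > 0"
  shows "qfac (u * Q ^ m) Q k * qfac (u * Q) Q (m - 1) = qfac (u * Q) Q k * qfac (u * Q ^ k * Q) Q (m - 1)"
proof -
  have "u * Q ^ m = u * Q * Q ^ (m - 1)"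
    using assms by (cases m) auto
  then have "qfac (u * Q ^ m) Q k * qfac (u * Q) Q (m - 1) = qfac (u * Q) Q (m - 1 + k)"
    by (simp add: qfac_add mult.commute)
  also have "\<dots> = qfac (u * Q) Q (k + (m - 1))"
    by (simp add: add.commute)
  also have "\<dots> = qfac (u * Q) Q k * qfac (u * Q ^ k * Q) Q (m - 1)"
    by (subst qfac_add) (simp add: mult_ac)
  finally show ?thesis .
qed

text \<open>Induction on \<open>N\<close> through a \<open>q\<close>-Pascal rule: passing from
  \<open>N\<close> to N + 1 multiplies the generating polynomial in \<open>z\<close> by the new
  linear factor.\<close>

lemma q_binomial:
  fixes Q :: "'a::field"
  assumes "Q \<noteq> 0" "\<And>i. 0 < i \<Longrightarrow> i \<le> N \<Longrightarrow> Q ^ i \<noteq> 1"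
  shows "(\<Sum>k\<le>N. qfac (inverse (Q ^ N)) Q k / qfac Q Q k * z ^ k) = (\<Prod>i<N. 1 - z * inverse (Q ^ Suc i))"
  using assms(2)
proof (induction N)
  case 0
  then show ?case by simp
next
  case (Suc N)
  define a where "a M k = qfac (inverse (Q ^ M)) Q k / qfac Q Q k" for M k
  have nz: "qfac Q Q k \<noteq> 0" if "k \<le> Suc N" for k
    using Suc.prems[of "Suc _"] that by (fastforce simp: qfac_eq_0_iff)
  have lead: "qfac (inverse (Q ^ Suc N)) Q (Suc k) = (1 - inverse (Q ^ Suc N)) * qfac (inverse (Q ^ N)) Q k" for k
  proof -
    have "inverse (Q ^ Suc N) * Q = inverse (Q ^ N)"
      using \<open>Q \<noteq> 0\<close> by (simp add: field_simps)
    then show ?thesis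
      by (simp only: qfac_Suc_left)
  qed
  have step: "a (Suc N) (Suc k) = a N (Suc k) - inverse (Q ^ Suc N) * a N k" if "k \<le> N" for k
  proof -
    have "qfac Q Q k \<noteq> 0" "1 - Q * Q ^ k \<noteq> 0"
      using nz[of "Suc k"] that by (auto simp: qfac_Suc)
    then show ?thesis
      unfolding a_def lead using \<open>Q \<noteq> 0\<close> by (simp add: qfac_Suc field_simps)
  qed
  \<comment> \<open>The factor with i = N is 1 - Q^(-N) Q^N = 0, so extending the sum by one index
    costs nothing.\<close>
  have top: "a N (Suc N) = 0"
    using \<open>Q \<noteq> 0\<close> by (simp add: a_def qfac_Suc)
  have "(\<Sum>k\<le>Suc N. a (Suc N) k * z ^ k) = 1 + (\<Sum>k\<le>N. a (Suc N) (Suc k) * z ^ Suc k)"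
    by (subst sum.atMost_Suc_shift) (simp add: a_def)
  also have "(\<Sum>k\<le>N. a (Suc N) (Suc k) * z ^ Suc k)
      = (\<Sum>k\<le>N. a N (Suc k) * z ^ Suc k - z * inverse (Q ^ Suc N) * (a N k * z ^ k))"
    by (intro sum.cong) (simp_all add: step algebra_simps)
  also have "\<dots> = (\<Sum>k\<le>N. a N (Suc k) * z ^ Suc k) - z * inverse (Q ^ Suc N) * (\<Sum>k\<le>N. a N k * z ^ k)"
    by (simp add: sum_subtractf sum_distrib_left)
  also have "1 + \<dots> = (\<Sum>k\<le>Suc N. a N k * z ^ k) - z * inverse (Q ^ Suc N) * (\<Sum>k\<le>N. a N k * z ^ k)"
    by (subst sum.atMost_Suc_shift) (simp add: a_def)
  also have "\<dots> = (\<Sum>k\<le>N. a N k * z ^ k) * (1 - z * inverse (Q ^ Suc N))"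
    by (simp add: top algebra_simps)
  also have "(\<Sum>k\<le>N. a N k * z ^ k) = (\<Prod>i<N. 1 - z * inverse (Q ^ Suc i))"
    unfolding a_def using Suc by simp
  finally show ?case
    by (simp add: a_def)
qed

text \<open>By linearity only monomials z^j with 1 \<le> j \<le> N matter. For these the product in
  \<open>q_binomial\<close> at z = Q^j contains the zero factor of index j - 1.\<close>

lemma q_binomial_annihilates:
  fixes Q :: "'a::field"
  assumes "Q \<noteq> 0" "\<And>i. 0 < i \<Longrightarrow> i \<le> N \<Longrightarrow> Q ^ i \<noteq> 1"
    and "coeff f 0 = 0" "degree f \<le> N"
  shows "(\<Sum>k\<le>N. qfac (inverse (Q ^ N)) Q k / qfac Q Q k * poly f (Q ^ k)) = 0"
proof -
  define a where "a k = qfac (inverse (Q ^ N)) Q k / qfac Q Q k" for k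
  have "(\<Sum>k\<le>N. a k * poly f (Q ^ k)) = (\<Sum>j\<le>degree f. coeff f j * (\<Sum>k\<le>N. a k * (Q ^ j) ^ k))"
    unfolding poly_altdef sum_distrib_left
    by (subst sum.swap) (simp add: power_mult [symmetric] mult_ac)
  also have "\<dots> = 0"
  proof (rule sum.neutral, safe)
    fix j assume "j \<le> degree f"
    show "coeff f j * (\<Sum>k\<le>N. a k * (Q ^ j) ^ k) = 0"
    proof (cases j)
      case 0
      then show ?thesis using assms(3) by simp
    next
      case (Suc i)
      with \<open>j \<le> degree f\<close> assms(4) have "i < N" by auto
      moreover have "1 - Q ^ j * inverse (Q ^ Suc i) = 0"
        unfolding Suc using assms(1) by (subst right_inverse) auto
      ultimately have "(\<Prod>i<N. 1 - Q ^ j * inverse (Q ^ Suc i)) = 0"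
        by (intro prod_zero) auto
      then show ?thesis
        unfolding a_def using q_binomial[OF assms(1,2)] by simp
    qed
  qed
  finally show ?thesis by (simp add: a_def)
qed

text \<open>The hypothesis says that b Q^j and c Q^k are inverse to each other when j + k = N - 1.
  Hence each of the last \<open>k\<close> factors of (b;Q)_N becomes a factor of (c;Q)_k after
  multiplication by a monomial.\<close>

lemma qfac_reflect:
  fixes Q :: "'a::field"
  assumes "b * c * Q ^ N = Q" "Q \<noteq> 0" "k \<le> N"
  shows "qfac b Q N * ((- c) ^ k * Q ^ (k choose 2)) = qfac b Q (N - k) * qfac c Q k"
  using \<open>k \<le> N\<close>
proof (induction k)
  case 0
  then show ?case by (simp add: numeral_2_eq_2)
next
  case (Suc k)
  define j where "j = N - Suc k"
  have j: "N - k = Suc j" "N = Suc (j + k)"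
    using Suc.prems by (auto simp: j_def)
  have "b * c * Q ^ (j + k) = 1"
    using assms(1,2) by (simp add: j(2) mult_ac)
  then have *: "(1 - b * Q ^ j) * ((- c) * Q ^ k) = 1 - c * Q ^ k"
    by (simp add: power_add algebra_simps)
  have "qfac b Q N * ((- c) ^ Suc k * Q ^ (Suc k choose 2))
      = qfac b Q N * ((- c) ^ k * Q ^ (k choose 2)) * ((- c) * Q ^ k)"
    by (simp add: numeral_2_eq_2 power_add mult_ac)
  also have "\<dots> = qfac b Q j * qfac c Q k * ((1 - b * Q ^ j) * ((- c) * Q ^ k))"
    using Suc by (simp add: j(1) qfac_Suc mult_ac)
  finally show ?case
    unfolding * by (simp add: j_def qfac_Suc mult_ac)
qed

text \<open>Two uses of \<open>qfac_reflect\<close>, with \<open>b\<close> and \<open>c\<close>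
  interchanged in the second; the quadratic powers of \<open>Q\<close> cancel in the quotient and
  only a geometric factor in \<open>k\<close> remains. This supplies the reflection hypothesis of
  \<open>antisymmetric_sum_zero\<close>.\<close>

lemma qfac_quotient_reflect:
  fixes Q :: "'a::field"
  assumes "b * c * Q ^ N = Q" "Q \<noteq> 0" "k \<le> N" "qfac c Q N \<noteq> 0"
  shows "qfac b Q (N - k) / qfac c Q (N - k)
    = inverse ((- c) ^ N * Q ^ (N choose 2)) * (c / b) ^ k * (qfac b Q k / qfac c Q k)"
proof -
  have nz: "b \<noteq> 0" "c \<noteq> 0"
    using assms(1,2) by auto
  define B C where "B = qfac b Q N" and "C = qfac c Q N"
  define r where "r = Q ^ (k choose 2)"
  have r: "r \<noteq> 0" using assms(2) by (simp add: r_def)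
  have cnz: "qfac c Q j \<noteq> 0" if "j \<le> N" for j
    using assms(4) that by (auto simp: qfac_eq_0_iff)
  have B: "B * ((- c) ^ N * Q ^ (N choose 2)) = C"
    using qfac_reflect[of b c Q N N] assms by (simp add: B_def C_def)
  have eB: "B * ((- c) ^ k * r) = qfac b Q (N - k) * qfac c Q k"
    using qfac_reflect[OF assms(1-3)] by (simp add: B_def r_def)
  have eC: "C * ((- b) ^ k * r) = qfac c Q (N - k) * qfac b Q k"
    using qfac_reflect[of c b Q N k] assms by (simp add: C_def r_def mult_ac)
  have "C \<noteq> 0" using assms(4) by (simp add: C_def)
  with eC nz r have "qfac b Q k \<noteq> 0" by auto
  have 1: "qfac b Q (N - k) = B * ((- c) ^ k * r) / qfac c Q k"
    using eB cnz[OF assms(3)] by (simp add: field_simps)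
  have 2: "qfac c Q (N - k) = C * ((- b) ^ k * r) / qfac b Q k"
    using eC \<open>qfac b Q k \<noteq> 0\<close> by (simp add: field_simps)
  have "B \<noteq> 0" using B \<open>C \<noteq> 0\<close> by auto
  \<comment> \<open>The constant in front is the quotient of the two full products, read off from
    the reflection with k = N.\<close>
  then have 3: "inverse ((- c) ^ N * Q ^ (N choose 2)) = B / C"
    using B \<open>C \<noteq> 0\<close> nz assms(2) by (simp add: field_simps)
  have 4: "(- c) ^ k = (c / b) ^ k * (- b) ^ k"
    using nz by (simp flip: power_mult_distrib)
  have cancel: "x * (t * s * r) / v / (y * (s * r) / w) = x / y * t * (w / v)"
    if "s \<noteq> 0" "y \<noteq> 0" "v \<noteq> 0" "w \<noteq> 0" for x y t s v w
    using that r by (simp add: divide_simps)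
  show ?thesis
    unfolding 1 2 3 4 using nz \<open>C \<noteq> 0\<close> \<open>qfac b Q k \<noteq> 0\<close> cnz[OF assms(3)]
    by (intro cancel) auto
qed

text \<open>The last two hypotheses say exactly that the terms \<open>k\<close> and \<open>N - k\<close> cancel.\<close>

lemma antisymmetric_sum_zero:
  fixes Q z :: "'a::field_char_0"
  assumes "Q \<noteq> 0" "z \<noteq> 0"
    and B: "\<And>k. k \<le> N \<Longrightarrow> B (N - k) = \<kappa> * \<gamma> ^ k * B k"
    and "\<gamma> = Q\<^sup>2 * z\<^sup>2" "\<kappa> * (Q * z) ^ N = 1"
  shows "(\<Sum>k\<le>N. (1 - Q ^ (2 * k) * inverse (Q ^ N)) * B k * z ^ k) = 0"
proof -
  define t where "t k = (1 - Q ^ (2 * k) * inverse (Q ^ N)) * B k * z ^ k" for k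
  have anti: "t (N - k) = - t k" if "k \<le> N" for k
  proof -
    define a b u v where "a = Q ^ k" and "b = Q ^ (N - k)" and "u = z ^ k" and "v = z ^ (N - k)"
    have nz: "a \<noteq> 0" "b \<noteq> 0" "u \<noteq> 0" "v \<noteq> 0"
      using assms(1,2) by (simp_all add: a_def b_def u_def v_def)
    have QN: "Q ^ N = a * b" and zN: "z ^ N = u * v"
      using that by (simp_all add: a_def b_def u_def v_def flip: power_add)
    have "\<gamma> ^ k = a * a * (u * u)"
      by (simp add: assms(4) a_def u_def power2_eq_square power_mult_distrib)
    then have B': "B (N - k) = \<kappa> * (a * a * (u * u)) * B k"
      using B[OF that] by simp
    have \<kappa>: "\<kappa> * (a * b * (u * v)) = 1"
      using assms(5) by (simp add: power_mult_distrib QN zN)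
    have "t (N - k) = (1 - b * b * inverse (a * b)) * (\<kappa> * (a * a * (u * u)) * B k) * v"
      unfolding t_def B' QN by (simp add: b_def v_def mult_2 power_add)
    also have "\<dots> = - ((1 - a * a * inverse (a * b)) * B k * u) * (\<kappa> * (a * b * (u * v)))"
      using nz by (simp add: field_simps)
    also have "(1 - a * a * inverse (a * b)) * B k * u = t k"
      unfolding t_def QN by (simp add: a_def u_def mult_2 power_add)
    finally show ?thesis
      by (simp add: \<kappa>)
  qed
  have "(\<Sum>k\<le>N. t k) = (\<Sum>k\<le>N. t (N - k))"
    using sum.nat_diff_reindex[of t "Suc N"] by (simp add: lessThan_Suc_atMost)
  also have "\<dots> = - (\<Sum>k\<le>N. t k)"
    by (simp add: anti sum_negf)
  finally show ?thesis
    by (simp add: t_def)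
qed

section \<open>Vanishing of the modified sums for generic base\<close>

lemma twice_triangle: "2 * (k * (k - 1) div 2) = k * (k - 1)" for k :: nat
  by (rule dvd_mult_div_cancel) (cases "even k"; simp)

lemma qfac_inverse_power_eq_0:
  fixes Q :: "'a::field"
  assumes "Q \<noteq> 0" "N < k"
  shows "qfac (inverse (Q ^ N)) Q k = 0"
  using assms by (auto simp: qfac_eq_0_iff intro!: exI[of _ N])

lemma poly_qfac: "poly (\<Prod>i<k. [:1, - (Q * Q ^ i):]) z = qfac (z * Q) Q k"
  by (simp add: poly_prod qfac_def mult_ac)

lemma degree_qfac: "degree (\<Prod>i<k. [:1, - (Q * Q ^ i):]) \<le> k" for Q :: "'a::idom"
  by (rule order.trans[OF degree_prod_sum_le]) (auto intro!: sum_bounded_above[where K = 1, simplified, THEN order.trans])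

text \<open>Here d = 2e + 1. The summand is (Q^(-N);Q)_k / (Q;Q)_k times a polynomial in Q^k, which
  \<open>q_binomial_annihilates\<close> kills. \<open>Q\<close> is not assumed to be a root of
  unity, so the sum vanishes on a whole neighbourhood and can be differentiated. The free parameter
  \<open>c\<close> is later set to \<open>q\<close>.\<close>

lemma odd_sum_eq_0:
  fixes Q c :: "'a::field"
  assumes "e \<ge> 2" "(2 * e + 1) * m = n + 1" "Q \<noteq> 0" "qfac Q Q (n - 1) \<noteq> 0"
  shows "(\<Sum>k<n. (1 - c * Q ^ (2 * k)) * (qfac (inverse (Q ^ (n - m))) Q k * qfac (Q ^ m) Q k ^ (2 * e))
    / (qfac Q Q k * qfac Q Q k ^ (2 * e)) * Q ^ ((e - 1) * k)) = 0"
proof -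
  define N where "N = n - m"
  have "m > 0" using assms(2) by (cases m) auto
  have n: "n = 2 * e * m + m - 1" using assms(2) by (simp add: algebra_simps)
  have N: "N = 2 * e * m - 1" unfolding N_def n using \<open>m > 0\<close> assms(1) by simp
  have "2 * e * m > 0" using \<open>m > 0\<close> assms(1) by simp
  then have "N < n" unfolding N n using \<open>m > 0\<close> by linarith
  define P where "P = (\<Prod>i<m-1. [:1, - (Q * Q ^ i):])"
  define f where "f = [:1, 0, - c:] * P ^ (2 * e) * monom 1 (e - 1)"
  define R where "R = qfac Q Q (m - 1)"
  have nz: "qfac Q Q k \<noteq> 0" if "k < n" for k
    using assms(4) that by (auto simp: qfac_eq_0_iff)
  have ne: "Q ^ i \<noteq> 1" if "0 < i" "i < n" for i
    using nz[OF that(2)] that(1) by (auto simp: qfac_eq_0_iff dest: spec[of _ "i - 1"] simp flip: power_Suc)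
  have "m - 1 < n" unfolding n using \<open>m > 0\<close> assms(1) by (cases e) auto
  then have R: "R \<noteq> 0" using nz by (simp add: R_def)
  have quot: "qfac (Q ^ m) Q k / qfac Q Q k = poly P (Q ^ k) / R" if "k < n" for k
    using qfac_shift[OF \<open>m > 0\<close>, of 1 Q k] nz[OF that] R
    by (simp add: P_def poly_qfac R_def field_simps)
  have "degree f \<le> degree [:1, 0, - c:] + degree P * (2 * e) + (e - 1)"
    unfolding f_def
    by (intro order.trans[OF degree_mult_le] add_mono degree_power_le degree_monom_le order.refl)
  also have "\<dots> \<le> 2 + (m - 1) * (2 * e) + (e - 1)"
    using degree_qfac[of Q "m - 1"] by (intro add_mono mult_right_mono) (auto simp: P_def)
  \<comment> \<open>The bound amounts to e \<ge> 2, since N = 2em - 1. The same condition gives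
    \<open>f\<close> a zero constant term through its factor z^(e-1).\<close>
  also have "\<dots> \<le> N"
  proof -
    obtain a b where "m = Suc a" "e = Suc (Suc b)"
      using \<open>m > 0\<close> assms(1) by (metis Suc_pred' add_2_eq_Suc' le_add_diff_inverse2)
    then show ?thesis by (simp add: N algebra_simps)
  qed
  finally have deg: "degree f \<le> N" .
  have coeff: "coeff f 0 = 0"
    using assms(1) by (simp add: f_def coeff_mult)
  have "(\<Sum>k<n. (1 - c * Q ^ (2 * k)) * (qfac (inverse (Q ^ N)) Q k * qfac (Q ^ m) Q k ^ (2 * e))
      / (qfac Q Q k * qfac Q Q k ^ (2 * e)) * Q ^ ((e - 1) * k))
    = (\<Sum>k<n. (qfac (inverse (Q ^ N)) Q k / qfac Q Q k) * poly f (Q ^ k) / R ^ (2 * e))"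
  proof (intro sum.cong refl)
    fix k assume "k \<in> {..<n}"
    then have k: "k < n" by simp
    have "(qfac (inverse (Q ^ N)) Q k / qfac Q Q k) * poly f (Q ^ k) / R ^ (2 * e)
      = (qfac (inverse (Q ^ N)) Q k / qfac Q Q k) * (1 - c * Q ^ (2 * k)) * (poly P (Q ^ k) / R) ^ (2 * e) * Q ^ ((e - 1) * k)"
    proof -
      have "Q ^ (2 * k) = Q ^ k * Q ^ k" by (simp add: mult_2 power_add)
      then have "poly f (Q ^ k) = (1 - c * Q ^ (2 * k)) * poly P (Q ^ k) ^ (2 * e) * Q ^ ((e - 1) * k)"
        by (simp add: f_def poly_monom flip: power_mult) (simp add: algebra_simps)
      then show ?thesis
        by (simp add: power_divide)
    qed
    also have "\<dots> = (1 - c * Q ^ (2 * k)) * (qfac (inverse (Q ^ N)) Q k * qfac (Q ^ m) Q k ^ (2 * e))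
      / (qfac Q Q k * qfac Q Q k ^ (2 * e)) * Q ^ ((e - 1) * k)"
      by (simp add: power_divide mult_ac flip: quot[OF k])
    finally show "(1 - c * Q ^ (2 * k)) * (qfac (inverse (Q ^ N)) Q k * qfac (Q ^ m) Q k ^ (2 * e))
      / (qfac Q Q k * qfac Q Q k ^ (2 * e)) * Q ^ ((e - 1) * k)
      = (qfac (inverse (Q ^ N)) Q k / qfac Q Q k) * poly f (Q ^ k) / R ^ (2 * e)" ..
  qed
  also have "\<dots> = (\<Sum>k\<le>N. (qfac (inverse (Q ^ N)) Q k / qfac Q Q k) * poly f (Q ^ k) / R ^ (2 * e))"
    using \<open>N < n\<close> assms(3) by (intro sum.mono_neutral_right) (auto simp: qfac_inverse_power_eq_0)
  also have "\<dots> = (\<Sum>k\<le>N. (qfac (inverse (Q ^ N)) Q k / qfac Q Q k) * poly f (Q ^ k)) / R ^ (2 * e)"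
    by (simp add: sum_divide_distrib)
  also have "\<dots> = 0"
    using q_binomial_annihilates[OF assms(3) _ coeff deg] ne \<open>N < n\<close> by simp
  finally show ?thesis
    by (simp add: N_def)
qed

text \<open>Here d = 2e, and \<open>p\<close> stands for q^e, a square root of \<open>Q\<close> that
  makes the half-integer powers available. The factor l = Q^(-n/2) puts the parameters lQ^m and lQ
  in the position required for reflection, so the terms \<open>k\<close> and N - k cancel for
  generic \<open>p\<close>.\<close>

lemma even_sum_eq_0:
  fixes p :: "'a::field_char_0" and n m e :: nat
  defines "Q \<equiv> p\<^sup>2" and "l \<equiv> inverse (p ^ n)"
  assumes "e \<ge> 2" "2 * e * m = n + 1" "p \<noteq> 0" "qfac Q Q (n - 1) \<noteq> 0" "qfac (l * Q) Q (n - 1) \<noteq> 0"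
  shows "(\<Sum>k<n. (1 - Q ^ (2 * k) * inverse (Q ^ (n - m)))
    * (qfac (inverse (Q ^ (n - m))) Q k * qfac (l * Q ^ m) Q k ^ (2 * e - 1))
    / (qfac Q Q k * qfac (l * Q) Q k ^ (2 * e - 1)) * p ^ ((2 * e - 3) * k)) = 0"
proof -
  define N where "N = n - m"
  have "m > 0" using assms(4) by (cases m) auto
  have n: "n = 2 * e * m - 1" using assms(4) by simp
  have "m \<le> n"
    unfolding n using \<open>m > 0\<close> assms(3) by (cases e) (auto simp: algebra_simps)
  then have Nm: "N + m = n" by (simp add: N_def)
  have "N < n" using Nm \<open>m > 0\<close> by simp
  then have "n > 0" by simp
  have nzQ: "Q \<noteq> 0" "l \<noteq> 0" using assms(5) by (simp_all add: Q_def l_def)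
  obtain f where e: "e = Suc (Suc f)"
    using assms(3) by (metis add_2_eq_Suc le_Suc_ex)
  have nz: "qfac Q Q k \<noteq> 0" "qfac (l * Q) Q k \<noteq> 0" if "k \<le> N" for k
    using assms(6,7) that \<open>N < n\<close> by (auto simp: qfac_eq_0_iff)
  define B where "B k = qfac (inverse (Q ^ N)) Q k / qfac Q Q k * (qfac (l * Q ^ m) Q k / qfac (l * Q) Q k) ^ (2 * e - 1)" for k
  define \<kappa> where "\<kappa> = inverse ((- Q) ^ N * Q ^ (N choose 2)) * inverse ((- (l * Q)) ^ N * Q ^ (N choose 2)) ^ (2 * e - 1)"
  define \<gamma> where "\<gamma> = Q / inverse (Q ^ N) * (l * Q / (l * Q ^ m)) ^ (2 * e - 1)"
  have "l\<^sup>2 * Q ^ n = 1"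
    using assms(5) by (simp add: l_def Q_def field_simps flip: power_mult)
  then have prod2: "(l * Q ^ m) * (l * Q) * Q ^ N = Q"
    by (simp add: power2_eq_square mult_ac flip: Nm power_add)
  have refl: "B (N - k) = \<kappa> * \<gamma> ^ k * B k" if "k \<le> N" for k
  proof -
    have 1: "qfac (inverse (Q ^ N)) Q (N - k) / qfac Q Q (N - k)
        = inverse ((- Q) ^ N * Q ^ (N choose 2)) * (Q / inverse (Q ^ N)) ^ k * (qfac (inverse (Q ^ N)) Q k / qfac Q Q k)"
      using nzQ nz that by (intro qfac_quotient_reflect) auto
    have 2: "qfac (l * Q ^ m) Q (N - k) / qfac (l * Q) Q (N - k)
        = inverse ((- (l * Q)) ^ N * Q ^ (N choose 2)) * (l * Q / (l * Q ^ m)) ^ k * (qfac (l * Q ^ m) Q k / qfac (l * Q) Q k)"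
      using nzQ nz that prod2 by (intro qfac_quotient_reflect) auto
    show ?thesis
      unfolding B_def 1 2 \<kappa>_def \<gamma>_def power_mult_distrib
      by (simp add: mult_ac flip: power_mult)
  qed
  \<comment> \<open>Comparison of exponents of \<open>Q\<close>, using N + m = n and 2em = n + 1;
    multiplying by a power of Q^m first avoids negative exponents.\<close>
  have gam: "\<gamma> = Q\<^sup>2 * (p ^ (2 * e - 3))\<^sup>2"
  proof -
    have "\<gamma> * (Q ^ m) ^ (2 * e - 1) = Q * Q ^ N * Q ^ (2 * e - 1)"
      using nzQ by (simp add: \<gamma>_def power_divide power_mult_distrib field_simps)
    also have "\<dots> = Q ^ (Suc N + (2 * e - 1))"
      by (simp add: power_add)
    also have "Suc N + (2 * e - 1) = 2 + (2 * e - 3) + m * (2 * e - 1)"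
      using Nm assms(4) by (simp add: e algebra_simps)
    also have "Q ^ \<dots> = Q\<^sup>2 * (p ^ (2 * e - 3))\<^sup>2 * (Q ^ m) ^ (2 * e - 1)"
      by (simp add: power_add Q_def flip: power_mult) (simp add: mult_ac)
    finally show ?thesis
      using nzQ by simp
  qed
  have kap: "\<kappa> * (Q * p ^ (2 * e - 3)) ^ N = 1"
  proof -
    have "inverse \<kappa> = (- 1) ^ N * ((- 1) ^ N) ^ (2 * e - 1) * l ^ (N * (2 * e - 1)) * Q ^ ((N + (N choose 2)) * (2 * e))"
    proof -
      define X where "X = Q ^ (N + (N choose 2))"
      have 1: "(- Q) ^ N * Q ^ (N choose 2) = (- 1) ^ N * X"
        unfolding X_def power_minus[of Q] by (simp add: power_add)
      have 2: "(- (l * Q)) ^ N * Q ^ (N choose 2) = (- 1) ^ N * l ^ N * X"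
        unfolding X_def power_minus[of "l * Q"] by (simp add: power_add power_mult_distrib)
      have "X * X ^ (2 * e - 1) = Q ^ ((N + (N choose 2)) * (2 * e))"
        by (simp add: X_def e flip: power_mult power_add)
      then have X: "Q ^ ((N + (N choose 2)) * (2 * e)) = X * X ^ (2 * e - 1)" ..
      show ?thesis
        unfolding \<kappa>_def 1 2 X
        by (simp only: power_inverse inverse_mult_distrib inverse_inverse_eq power_mult_distrib power_mult mult_ac)
    qed
    \<comment> \<open>The signs occur 2e times in total, so for even \<open>d\<close> they cancel
      without any appeal to roots of unity.\<close>
    also have "(- 1 :: 'a) ^ N * ((- 1) ^ N) ^ (2 * e - 1) = ((- 1) ^ N) ^ (2 * e)"
      by (simp add: e)
    also have "\<dots> = 1"
      by (simp flip: power_mult)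
    finally have "inverse \<kappa> * p ^ (n * (N * (2 * e - 1))) = Q ^ ((N + (N choose 2)) * (2 * e))"
      using assms(5) by (simp add: l_def power_mult power_inverse)
    also have "\<dots> = p ^ ((2 * N + 2 * (N choose 2)) * (2 * e))"
      by (simp add: Q_def algebra_simps flip: power_mult)
    also have "2 * (N choose 2) = N * (N - 1)"
      unfolding choose_two by (rule twice_triangle)
    also have "(2 * N + N * (N - 1)) * (2 * e) = (2 + (2 * e - 3)) * N + n * (N * (2 * e - 1))"
    proof -
      have "2 * N + N * (N - 1) = N * (N + 1)" by (cases N) auto
      moreover have "(N + 1) * (2 * e) = (2 + (2 * e - 3)) + n * (2 * e - 1)"
      proof -
        have "int N = int n - int m" using Nm by linarith
        moreover have "2 * int e * int m = int n + 1" using arg_cong[OF assms(4), of int] by simp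
        ultimately have "(int N + 1) * (2 * int e) = (2 + (2 * int e - 3)) + int n * (2 * int e - 1)"
          by algebra
        then have "int ((N + 1) * (2 * e)) = int ((2 + (2 * e - 3)) + n * (2 * e - 1))"
          by (simp add: e algebra_simps)
        then show ?thesis by linarith
      qed
      ultimately have "(2 * N + N * (N - 1)) * (2 * e) = N * ((2 + (2 * e - 3)) + n * (2 * e - 1))"
        by (simp only: mult.assoc)
      then show ?thesis
        by (simp only: add_mult_distrib2 mult_ac)
    qed
    also have "p ^ \<dots> = (Q * p ^ (2 * e - 3)) ^ N * p ^ (n * (N * (2 * e - 1)))"
      by (simp only: Q_def power_add power_mult)
    finally have "inverse \<kappa> = (Q * p ^ (2 * e - 3)) ^ N"
      using assms(5) by simp
    moreover have "\<kappa> \<noteq> 0" using nzQ by (simp add: \<kappa>_def)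
    ultimately show ?thesis
      by (metis right_inverse)
  qed
  have "(\<Sum>k<n. (1 - Q ^ (2 * k) * inverse (Q ^ N))
    * (qfac (inverse (Q ^ N)) Q k * qfac (l * Q ^ m) Q k ^ (2 * e - 1))
    / (qfac Q Q k * qfac (l * Q) Q k ^ (2 * e - 1)) * p ^ ((2 * e - 3) * k))
    = (\<Sum>k<n. (1 - Q ^ (2 * k) * inverse (Q ^ N)) * B k * (p ^ (2 * e - 3)) ^ k)"
    by (simp add: B_def power_divide power_mult)
  also have "\<dots> = (\<Sum>k\<le>N. (1 - Q ^ (2 * k) * inverse (Q ^ N)) * B k * (p ^ (2 * e - 3)) ^ k)"
    using \<open>N < n\<close> nzQ by (intro sum.mono_neutral_right) (auto simp: B_def qfac_inverse_power_eq_0)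
  also have "\<dots> = 0"
    using antisymmetric_sum_zero[OF nzQ(1) _ refl gam kap] assms(5) by simp
  finally show ?thesis
    by (simp add: N_def)
qed

section \<open>Vanishing at primitive roots of order (d-1)n\<close>

lemma primitive_root_half_power:
  fixes x :: "'a::idom"
  assumes "\<And>j. x ^ j = 1 \<longleftrightarrow> M dvd j" "M > 0"
  shows "x ^ (M * (M - 1) div 2) = (- 1) ^ (M - 1)"
proof (cases "odd M")
  case True
  then obtain h where h: "M = 2 * h + 1" by (elim oddE)
  then have "M * (M - 1) div 2 = M * h" by simp
  then show ?thesis
    using assms(1)[of M] h by (simp only: power_mult) simp
next
  case False
  then obtain h where h: "M = 2 * h" by (auto elim: evenE)
  \<comment> \<open>For M = 2h the element x^h squares to 1 and differs from 1, hence equals -1. For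
    odd \<open>M\<close> the exponent is a multiple of \<open>M\<close>.\<close>
  have "(x ^ h - 1) * (x ^ h + 1) = 0"
  proof -
    have "x ^ h * x ^ h = 1"
      using assms(1)[of M] by (simp only: h mult_2 power_add dvd_refl)
    then show ?thesis by (simp add: algebra_simps)
  qed
  moreover have "x ^ h \<noteq> 1"
    using assms by (auto simp: h dest: dvd_imp_le)
  ultimately have "x ^ h = - 1"
    by (simp add: add_eq_0_iff2)
  moreover have "M * (M - 1) div 2 = h * (M - 1)"
    by (simp add: h)
  ultimately show ?thesis
    by (simp add: power_mult)
qed

text \<open>The order is (d-1)n = dN + 1, so x Q^N = 1: the numerator (x;Q)_k terminates at
  \<open>N\<close>, and the unmodified sum is already antisymmetric under reflection.\<close>

lemma sum_eq_0_at_primitive_root: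
  fixes x :: "'a::field_char_0"
  assumes "d \<ge> 4" "d * m = n + 1" "\<And>j. x ^ j = 1 \<longleftrightarrow> (d * n - n) dvd j"
    and "qfac (x ^ d) (x ^ d) (n - 1) \<noteq> 0"
  shows "(\<Sum>k<n. (1 - x * (x ^ d) ^ (2 * k)) * (qfac x (x ^ d) k / qfac (x ^ d) (x ^ d) k) ^ d
     * x ^ (d * (d - 3) * k div 2)) = 0"
proof -
  define Q N M where "Q = x ^ d" and "N = n - m" and "M = d * n - n"
  have "m > 0" using assms(2) by (cases m) auto
  have "4 * m \<le> d * m" using assms(1) by simp
  then have "m \<le> n" "n > 0" using assms(2) \<open>m > 0\<close> by linarith+
  then have Nm: "N + m = n" and "N < n" using \<open>m > 0\<close> by (auto simp: N_def)
  have M: "M = Suc (d * N)"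
  proof -
    have "d * N + d * m = d * n" by (metis Nm add_mult_distrib2)
    then show ?thesis using assms(2) by (simp add: M_def)
  qed
  have "M > 0" by (simp add: M)
  have xM: "x ^ M = 1" using assms(3) by (simp add: M_def)
  then have "x \<noteq> 0" using \<open>M > 0\<close> by (auto simp: zero_power)
  then have "Q \<noteq> 0" by (simp add: Q_def)
  have xQ: "x * Q ^ N = 1"
    using xM by (simp add: M Q_def power_mult)
  then have x_eq: "x = inverse (Q ^ N)"
    by (metis inverse_unique mult.commute)
  have nz: "qfac Q Q k \<noteq> 0" if "k < n" for k
    using assms(4) that by (auto simp: qfac_eq_0_iff Q_def)
  define r where "r = d * (d - 3) div 2"
  define z where "z = x ^ r"
  have r: "2 * r = d * (d - 3)" by (cases "even d") (auto simp: r_def)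
  have z: "x ^ (d * (d - 3) * k div 2) = z ^ k" for k
    unfolding z_def power_mult [symmetric] r [symmetric] by simp
  define B where "B k = (qfac x Q k / qfac Q Q k) ^ d" for k
  define \<kappa> where "\<kappa> = inverse ((- Q) ^ N * Q ^ (N choose 2)) ^ d"
  have refl: "B (N - k) = \<kappa> * ((Q / x) ^ d) ^ k * B k" if "k \<le> N" for k
  proof -
    have "qfac x Q (N - k) / qfac Q Q (N - k)
        = inverse ((- Q) ^ N * Q ^ (N choose 2)) * (Q / x) ^ k * (qfac x Q k / qfac Q Q k)"
      using that \<open>Q \<noteq> 0\<close> nz[OF \<open>N < n\<close>] xQ by (intro qfac_quotient_reflect) (auto simp: mult_ac)
    then show ?thesis
      unfolding B_def \<kappa>_def by (simp only: power_mult_distrib mult_ac flip: power_mult)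
  qed
  have gam: "(Q / x) ^ d = Q\<^sup>2 * z\<^sup>2"
  proof -
    have "(Q / x) ^ d = Q ^ d / Q" by (simp add: power_divide) (simp add: Q_def)
    also have "\<dots> = Q ^ (2 + (d - 3))"
    proof -
      have "d = Suc (2 + (d - 3))" using assms(1) by simp
      then have "Q ^ d = Q * Q ^ (2 + (d - 3))" by (metis power_Suc)
      then show ?thesis using \<open>Q \<noteq> 0\<close> by simp
    qed
    also have "\<dots> = Q\<^sup>2 * z\<^sup>2"
    proof -
      have "z\<^sup>2 = x ^ (2 * r)" by (simp add: z_def mult.commute flip: power_mult)
      also have "\<dots> = Q ^ (d - 3)" by (simp only: r Q_def power_mult)
      finally show ?thesis by (simp only: power_add)
    qed
    finally show ?thesis .
  qed
  have kap: "\<kappa> * (Q * z) ^ N = 1"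
  proof -
    define s where "s = M * (M - 1) div 2"
    have s2: "2 * s = M * (M - 1)"
      unfolding s_def by (rule twice_triangle)
    have c2: "2 * (N choose 2) = N * (N - 1)" unfolding choose_two by (rule twice_triangle)
    \<comment> \<open>The sign left by the reflection, which can be -1 for odd \<open>d\<close>, is
      compensated by x^s = (-1)^(M-1) = (-1)^(dN).\<close>
    have "(- 1) ^ (N * d) * x ^ s = (- 1) ^ (N * d) * (- 1) ^ (N * d)"
      using primitive_root_half_power[of x M] assms(3) \<open>M > 0\<close>
      by (simp add: M_def [symmetric] s_def) (simp add: M mult.commute)
    then have sgn: "(- 1) ^ (N * d) * x ^ s = 1"
      by (simp flip: power_mult_distrib)
    have "inverse \<kappa> = (- 1) ^ (N * d) * Q ^ ((N + (N choose 2)) * d)"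
      by (simp add: \<kappa>_def power_minus[of Q] power_mult power_add power_mult_distrib power_inverse)
    also have "Q ^ ((N + (N choose 2)) * d) = x ^ (d * ((N + (N choose 2)) * d))"
      by (simp add: Q_def power_mult)
    \<comment> \<open>The identity is checked after doubling, which removes the halves in
      \<open>r\<close>, \<open>s\<close> and the binomial coefficient.\<close>
    also have "d * ((N + (N choose 2)) * d) = (d + r) * N + s"
    proof -
      have "2 * (d * ((N + (N choose 2)) * d)) = d * ((2 * N + 2 * (N choose 2)) * d)"
        by (simp add: algebra_simps)
      also have "2 * N + 2 * (N choose 2) = N * (N + 1)"
        unfolding c2 by (cases N) auto
      also have "d * (N * (N + 1) * d) = (2 * d + d * (d - 3)) * N + M * (M - 1)"
        using le_Suc_ex[OF assms(1)] by (auto simp: M algebra_simps)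
      also have "\<dots> = 2 * ((d + r) * N + s)"
        by (simp add: r s2 add_mult_distrib2 add_mult_distrib flip: mult.assoc)
      finally show ?thesis by simp
    qed
    also have "x ^ \<dots> = (Q * z) ^ N * x ^ s"
      by (simp add: Q_def z_def power_add power_mult power_mult_distrib)
    finally have "inverse \<kappa> = (Q * z) ^ N"
    proof -
      assume "inverse \<kappa> = (- 1) ^ (N * d) * ((Q * z) ^ N * x ^ s)"
      also have "\<dots> = (Q * z) ^ N * ((- 1) ^ (N * d) * x ^ s)"
        by (simp only: mult_ac)
      finally show ?thesis by (simp only: sgn mult_1_right)
    qed
    moreover have "\<kappa> \<noteq> 0" using \<open>Q \<noteq> 0\<close> by (simp add: \<kappa>_def)
    ultimately show ?thesis
      by (metis right_inverse)
  qed
  have "(\<Sum>k<n. (1 - x * Q ^ (2 * k)) * (qfac x Q k / qfac Q Q k) ^ d * x ^ (d * (d - 3) * k div 2))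
      = (\<Sum>k<n. (1 - Q ^ (2 * k) * inverse (Q ^ N)) * B k * z ^ k)"
    unfolding z B_def by (simp add: x_eq mult.commute)
  also have "\<dots> = (\<Sum>k\<le>N. (1 - Q ^ (2 * k) * inverse (Q ^ N)) * B k * z ^ k)"
    using \<open>N < n\<close> \<open>Q \<noteq> 0\<close> assms(1)
    by (intro sum.mono_neutral_right) (auto simp: B_def x_eq qfac_inverse_power_eq_0)
  also have "\<dots> = 0"
    using \<open>x \<noteq> 0\<close> by (intro antisymmetric_sum_zero[OF \<open>Q \<noteq> 0\<close> _ refl gam kap]) (simp add: z_def)
  finally show ?thesis
    by (simp add: Q_def)
qed

section \<open>A root-of-unity filter\<close>

lemma sum_poly_root_of_unity:
  fixes p :: "'a::field"
  assumes "p ^ n = 1" "\<And>j. j \<le> degree g \<Longrightarrow> p ^ (2 * j + s) = 1 \<Longrightarrow> j = J"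
  shows "\<exists>h. \<forall>\<mu>. (\<Sum>k<n. poly g (\<mu> * (p\<^sup>2) ^ k) * p ^ (s * k)) = h * \<mu> ^ J"
proof (intro exI allI)
  fix \<mu> :: 'a
  \<comment> \<open>Each monomial of \<open>g\<close> contributes a geometric sum over a full
    period, which is zero unless its ratio is 1; by hypothesis this can happen for the exponent
    \<open>J\<close> alone.\<close>
  have geo: "(\<Sum>k<n. (p ^ (2 * j + s)) ^ k) = 0" if "j \<le> degree g" "j \<noteq> J" for j
  proof -
    have "p ^ (2 * j + s) \<noteq> 1" using assms(2) that by auto
    moreover have "(p ^ (2 * j + s)) ^ n = 1"
    proof -
      have "(p ^ (2 * j + s)) ^ n = (p ^ n) ^ (2 * j + s)"
        by (simp only: mult.commute flip: power_mult)
      then show ?thesis using assms(1) by simp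
    qed
    ultimately show ?thesis
      by (simp add: sum_gp_strict)
  qed
  have "(\<Sum>k<n. poly g (\<mu> * (p\<^sup>2) ^ k) * p ^ (s * k))
      = (\<Sum>j\<le>degree g. coeff g j * \<mu> ^ j * (\<Sum>k<n. (p ^ (2 * j + s)) ^ k))"
  proof -
    have "poly g (\<mu> * (p\<^sup>2) ^ k) * p ^ (s * k) = (\<Sum>j\<le>degree g. coeff g j * \<mu> ^ j * (p ^ (2 * j + s)) ^ k)" for k
    proof -
      have "((p\<^sup>2) ^ k) ^ j * p ^ (s * k) = (p ^ (2 * j + s)) ^ k" for j
        by (simp add: algebra_simps flip: power_mult power_add)
      then show ?thesis
        by (simp add: poly_altdef sum_distrib_right power_mult_distrib mult.assoc)
    qed
    then show ?thesis
      by (simp only: sum_distrib_left) (rule sum.swap)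
  qed
  also have "\<dots> = (\<Sum>j\<in>{..degree g} \<inter> {J}. coeff g j * \<mu> ^ j * (\<Sum>k<n. (p ^ (2 * j + s)) ^ k))"
    using geo by (intro sum.mono_neutral_right) auto
  also have "\<dots> = coeff g J * (\<Sum>k<n. (p ^ (2 * J + s)) ^ k) * \<mu> ^ J"
    by (cases "J \<le> degree g") (auto simp: coeff_eq_0)
  finally show "(\<Sum>k<n. poly g (\<mu> * (p\<^sup>2) ^ k) * p ^ (s * k))
    = coeff g J * (\<Sum>k<n. (p ^ (2 * J + s)) ^ k) * \<mu> ^ J" .
qed

text \<open>With denominators cleared by \<open>qfac_shift\<close>, the summand is a polynomial in
  \<mu>Q^k times a power of \<open>p\<close>, and the filter leaves a single monomial in \<mu>.
  Since \<open>h\<close> does not depend on \<mu>, vanishing at one admissible nonzero \<mu> forces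
  vanishing at all admissible ones.\<close>

lemma shifted_sum_monomial:
  fixes p :: "'a::field"
  defines "Q \<equiv> p\<^sup>2"
  assumes "e \<ge> 2" "2 * e * m = n + 1" "\<And>j. p ^ j = 1 \<longleftrightarrow> n dvd j"
  shows "\<exists>h J. \<forall>\<mu>. qfac (\<mu> * Q) Q (n - 1) \<noteq> 0 \<longrightarrow>
    qfac (\<mu> * Q) Q (m - 1) ^ (2 * e) *
     (\<Sum>k<n. (1 - \<mu>\<^sup>2 * Q ^ m * Q ^ (2 * k)) * (qfac (\<mu> * Q ^ m) Q k / qfac (\<mu> * Q) Q k) ^ (2 * e) * p ^ ((2 * e - 3) * k)) = h * \<mu> ^ J"
proof -
  have "m > 0" using assms(3) by (cases m) auto
  obtain f where e: "e = Suc (Suc f)"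
    using assms(2) by (metis add_2_eq_Suc le_Suc_ex)
  obtain a where a: "m = Suc a" using \<open>m > 0\<close> by (cases m) auto
  have n: "n = 2 * e * a + 2 * e - 1" using assms(3) by (simp add: a)
  define P where "P = (\<Prod>i<m-1. [:1, - (Q * Q ^ i):])"
  define g where "g = [:1, 0, - (Q ^ m):] * P ^ (2 * e)"
  have "degree g \<le> degree [:1, 0, - (Q ^ m):] + degree P * (2 * e)"
    unfolding g_def
    by (intro order.trans[OF degree_mult_le] add_mono degree_power_le order.refl)
  also have "\<dots> \<le> 2 + (m - 1) * (2 * e)"
    using degree_qfac[of Q "m - 1"] by (intro add_mono mult_right_mono) (auto simp: P_def)
  also have "\<dots> = n + 3 - 2 * e"
    by (simp add: n a e algebra_simps)
  finally have deg: "degree g \<le> n + 3 - 2 * e" .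
  \<comment> \<open>The degree bound and e \<ge> 2 keep the exponent 2j + 2e - 3 strictly between 0
    and 2n, so it can be a multiple of \<open>n\<close> only by being equal to
    \<open>n\<close>.\<close>
  have J: "j = (n + 3 - 2 * e) div 2" if "j \<le> degree g" "p ^ (2 * j + (2 * e - 3)) = 1" for j
  proof -
    from that(2) obtain t where t: "2 * j + (2 * e - 3) = n * t"
      unfolding assms(4) by (elim dvdE)
    have "n * t < n * 2" unfolding t [symmetric] using that(1) deg by (simp add: n e)
    then have "t < 2" by simp
    moreover have "t \<noteq> 0" using t by (intro notI) (simp add: e)
    ultimately have "t = 1" by simp
    then show ?thesis using t by (simp add: e)
  qed
  have "p ^ n = 1" by (simp add: assms(4))
  from sum_poly_root_of_unity[OF this J]
  obtain h where "\<forall>\<mu>. (\<Sum>k<n. poly g (\<mu> * (p\<^sup>2) ^ k) * p ^ ((2 * e - 3) * k)) = h * \<mu> ^ ((n + 3 - 2 * e) div 2)"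
    by fast
  then have h: "(\<Sum>k<n. poly g (\<mu> * Q ^ k) * p ^ ((2 * e - 3) * k)) = h * \<mu> ^ ((n + 3 - 2 * e) div 2)" for \<mu>
    by (simp add: Q_def)
  show ?thesis
  proof (intro exI allI impI)
    fix \<mu> assume "qfac (\<mu> * Q) Q (n - 1) \<noteq> 0"
    then have nz: "qfac (\<mu> * Q) Q k \<noteq> 0" if "k < n" for k
      using that by (auto simp: qfac_eq_0_iff)
    have quot: "qfac (\<mu> * Q) Q (m - 1) * (qfac (\<mu> * Q ^ m) Q k / qfac (\<mu> * Q) Q k) = poly P (\<mu> * Q ^ k)" if "k < n" for k
      using qfac_shift[OF \<open>m > 0\<close>, of \<mu> Q k] nz[OF that]
      by (simp add: P_def poly_qfac field_simps)
    have "qfac (\<mu> * Q) Q (m - 1) ^ (2 * e) *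
     (\<Sum>k<n. (1 - \<mu>\<^sup>2 * Q ^ m * Q ^ (2 * k)) * (qfac (\<mu> * Q ^ m) Q k / qfac (\<mu> * Q) Q k) ^ (2 * e) * p ^ ((2 * e - 3) * k))
     = (\<Sum>k<n. poly g (\<mu> * Q ^ k) * p ^ ((2 * e - 3) * k))"
      unfolding sum_distrib_left
    proof (intro sum.cong refl)
      fix k assume "k \<in> {..<n}"
      then have k: "k < n" by simp
      have "poly g (\<mu> * Q ^ k) = (1 - \<mu>\<^sup>2 * Q ^ m * Q ^ (2 * k)) * poly P (\<mu> * Q ^ k) ^ (2 * e)"
      proof -
        have "Q ^ (2 * k) = Q ^ k * Q ^ k" by (simp add: mult_2 power_add)
        then show ?thesis by (simp add: g_def power2_eq_square algebra_simps)
      qed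
      then show "qfac (\<mu> * Q) Q (m - 1) ^ (2 * e) * ((1 - \<mu>\<^sup>2 * Q ^ m * Q ^ (2 * k)) * (qfac (\<mu> * Q ^ m) Q k / qfac (\<mu> * Q) Q k) ^ (2 * e) * p ^ ((2 * e - 3) * k))
       = poly g (\<mu> * Q ^ k) * p ^ ((2 * e - 3) * k)"
        unfolding quot[OF k, symmetric] by (simp only: power_mult_distrib mult_ac)
    qed
    then show "qfac (\<mu> * Q) Q (m - 1) ^ (2 * e) *
     (\<Sum>k<n. (1 - \<mu>\<^sup>2 * Q ^ m * Q ^ (2 * k)) * (qfac (\<mu> * Q ^ m) Q k / qfac (\<mu> * Q) Q k) ^ (2 * e) * p ^ ((2 * e - 3) * k))
      = h * \<mu> ^ ((n + 3 - 2 * e) div 2)"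
      by (simp add: h)
  qed
qed

section \<open>First-order comparison of functions at a point\<close>

text \<open>
  \<open>a\<close> is the value of \<open>x * f' / f\<close> at \<open>x\<close>; it is the exponent when \<open>f\<close> is a monomial.
\<close>

definition log_deriv :: "'a::real_normed_field \<Rightarrow> ('a \<Rightarrow> 'a) \<Rightarrow> 'a \<Rightarrow> bool" where
  "log_deriv x f a \<longleftrightarrow> (f has_field_derivative a * f x / x) (at x)"

lemma log_deriv_const: "log_deriv x (\<lambda>_. c) 0"
  by (simp add: log_deriv_def)

lemma log_deriv_ident: "x \<noteq> 0 \<Longrightarrow> log_deriv x (\<lambda>q. q) 1"
  by (simp add: log_deriv_def)

lemma log_deriv_mult: "log_deriv x f a \<Longrightarrow> log_deriv x g b \<Longrightarrow> log_deriv x (\<lambda>q. f q * g q) (a + b)"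
  unfolding log_deriv_def by (drule (1) DERIV_mult) (simp add: field_simps add_divide_distrib)

lemma log_deriv_power: "log_deriv x f a \<Longrightarrow> log_deriv x (\<lambda>q. f q ^ k) (of_nat k * a)"
proof (induction k)
  case (Suc k)
  then show ?case using log_deriv_mult[OF Suc.prems Suc.IH[OF Suc.prems]] by (simp add: algebra_simps)
qed (simp add: log_deriv_const)

lemma log_deriv_inverse:
  assumes "log_deriv x f a" "f x \<noteq> 0"
  shows "log_deriv x (\<lambda>q. inverse (f q)) (- a)"
  using DERIV_inverse_fun[OF assms(1)[unfolded log_deriv_def] assms(2)] assms(2)
  by (simp add: log_deriv_def field_simps)

text \<open>
  The two functions \<open>g\<close> and \<open>h\<close> take the same value as \<open>f\<close> and share its derivative between them.
  By the product rule this relation is compatible with products and quotients, so that first-order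
  comparisons of \<open>q\<close>-series can be made one linear factor at a time.
\<close>

definition deriv_split :: "'a::real_normed_field \<Rightarrow> ('a \<Rightarrow> 'a) \<Rightarrow> ('a \<Rightarrow> 'a) \<Rightarrow> ('a \<Rightarrow> 'a) \<Rightarrow> bool" where
  "deriv_split x f g h \<longleftrightarrow> g x = f x \<and> h x = f x \<and>
    (\<exists>D E. (f has_field_derivative D + E) (at x) \<and> (g has_field_derivative D) (at x)
      \<and> (h has_field_derivative E) (at x))"

lemma deriv_split_same: "log_deriv x f a \<Longrightarrow> deriv_split x f f (\<lambda>_. f x)"
  unfolding deriv_split_def log_deriv_def by (intro conjI exI[of _ "a * f x / x"] exI[of _ 0]) auto

lemma deriv_split_add:
  assumes "deriv_split x f g h" "deriv_split x f' g' h'"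
  shows "deriv_split x (\<lambda>q. f q + f' q) (\<lambda>q. g q + g' q) (\<lambda>q. h q + h' q)"
proof -
  obtain D E D' E' where *: "(f has_field_derivative D + E) (at x)" "(g has_field_derivative D) (at x)"
      "(h has_field_derivative E) (at x)" "(f' has_field_derivative D' + E') (at x)"
      "(g' has_field_derivative D') (at x)" "(h' has_field_derivative E') (at x)"
    using assms unfolding deriv_split_def by blast
  show ?thesis
    unfolding deriv_split_def
  proof (intro conjI exI)
    show "((\<lambda>q. f q + f' q) has_field_derivative (D + D') + (E + E')) (at x)"
      by (rule DERIV_cong[OF DERIV_add[OF *(1,4)]]) simp
    show "((\<lambda>q. g q + g' q) has_field_derivative D + D') (at x)"
      by (rule DERIV_add[OF *(2,5)])
    show "((\<lambda>q. h q + h' q) has_field_derivative E + E') (at x)"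
      by (rule DERIV_add[OF *(3,6)])
  qed (use assms in \<open>auto simp: deriv_split_def\<close>)
qed

lemma deriv_split_mult:
  assumes "deriv_split x f g h" "deriv_split x f' g' h'"
  shows "deriv_split x (\<lambda>q. f q * f' q) (\<lambda>q. g q * g' q) (\<lambda>q. h q * h' q)"
proof -
  obtain D E D' E' where *: "(f has_field_derivative D + E) (at x)" "(g has_field_derivative D) (at x)"
      "(h has_field_derivative E) (at x)" "(f' has_field_derivative D' + E') (at x)"
      "(g' has_field_derivative D') (at x)" "(h' has_field_derivative E') (at x)"
    using assms unfolding deriv_split_def by blast
  have v: "g x = f x" "h x = f x" "g' x = f' x" "h' x = f' x"
    using assms by (auto simp: deriv_split_def)
  show ?thesis
    unfolding deriv_split_def
  proof (intro conjI exI)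
    show "((\<lambda>q. f q * f' q) has_field_derivative (D * f' x + D' * f x) + (E * f' x + E' * f x)) (at x)"
      by (rule DERIV_cong[OF DERIV_mult[OF *(1,4)]]) (simp add: algebra_simps)
    show "((\<lambda>q. g q * g' q) has_field_derivative D * f' x + D' * f x) (at x)"
      by (rule DERIV_cong[OF DERIV_mult[OF *(2,5)]]) (simp add: v)
    show "((\<lambda>q. h q * h' q) has_field_derivative E * f' x + E' * f x) (at x)"
      by (rule DERIV_cong[OF DERIV_mult[OF *(3,6)]]) (simp add: v)
  qed (use v in auto)
qed

lemma deriv_split_inverse:
  assumes "deriv_split x f g h" "f x \<noteq> 0"
  shows "deriv_split x (\<lambda>q. inverse (f q)) (\<lambda>q. inverse (g q)) (\<lambda>q. inverse (h q))"
proof -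
  obtain D E where *: "(f has_field_derivative D + E) (at x)" "(g has_field_derivative D) (at x)"
      "(h has_field_derivative E) (at x)"
    using assms unfolding deriv_split_def by blast
  have v: "g x = f x" "h x = f x"
    using assms by (auto simp: deriv_split_def)
  let ?c = "- (inverse (f x) * inverse (f x))"
  show ?thesis
    unfolding deriv_split_def
  proof (intro conjI exI)
    show "((\<lambda>q. inverse (f q)) has_field_derivative ?c * D + ?c * E) (at x)"
      by (rule DERIV_cong[OF DERIV_inverse_fun[OF *(1)]]) (use assms(2) in \<open>auto simp: algebra_simps\<close>)
    show "((\<lambda>q. inverse (g q)) has_field_derivative ?c * D) (at x)"
      by (rule DERIV_cong[OF DERIV_inverse_fun[OF *(2)]]) (use v assms(2) in \<open>auto simp: algebra_simps\<close>)
    show "((\<lambda>q. inverse (h q)) has_field_derivative ?c * E) (at x)"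
      by (rule DERIV_cong[OF DERIV_inverse_fun[OF *(3)]]) (use v assms(2) in \<open>auto simp: algebra_simps\<close>)
  qed (use v in auto)
qed

lemma deriv_split_divide:
  assumes "deriv_split x f g h" "deriv_split x f' g' h'" "f' x \<noteq> 0"
  shows "deriv_split x (\<lambda>q. f q / f' q) (\<lambda>q. g q / g' q) (\<lambda>q. h q / h' q)"
  unfolding divide_inverse by (intro deriv_split_mult deriv_split_inverse assms)

lemma deriv_split_sum:
  fixes n :: nat
  assumes "\<And>k. k < n \<Longrightarrow> deriv_split x (f k) (g k) (h k)"
  shows "deriv_split x (\<lambda>q. \<Sum>k<n. f k q) (\<lambda>q. \<Sum>k<n. g k q) (\<lambda>q. \<Sum>k<n. h k q)"
  using assms
proof (induction n)
  case 0
  then show ?case using deriv_split_same[OF log_deriv_const[of x 0]] by simp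
qed (simp add: deriv_split_add)

lemma deriv_split_prod:
  fixes n :: nat
  assumes "\<And>k. k < n \<Longrightarrow> deriv_split x (f k) (g k) (h k)"
  shows "deriv_split x (\<lambda>q. \<Prod>k<n. f k q) (\<lambda>q. \<Prod>k<n. g k q) (\<lambda>q. \<Prod>k<n. h k q)"
  using assms
proof (induction n)
  case 0
  then show ?case using deriv_split_same[OF log_deriv_const[of x 1]] by simp
qed (simp add: deriv_split_mult)

text \<open>Exponents of monomials enter the derivative linearly, so splitting the exponent
  additively splits the derivative.\<close>

lemma deriv_split_one_minus:
  assumes "log_deriv x f (a + b)" "log_deriv x g a" "log_deriv x h b" "g x = f x" "h x = f x"
  shows "deriv_split x (\<lambda>q. 1 - f q) (\<lambda>q. 1 - g q) (\<lambda>q. 1 - h q)"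
  unfolding deriv_split_def
proof (intro conjI exI)
  show "((\<lambda>q. 1 - f q) has_field_derivative - (a * f x / x) + - (b * f x / x)) (at x)"
    by (rule DERIV_cong[OF DERIV_diff[OF DERIV_const assms(1)[unfolded log_deriv_def]]])
       (simp add: algebra_simps add_divide_distrib)
  show "((\<lambda>q. 1 - g q) has_field_derivative - (a * f x / x)) (at x)"
    by (rule DERIV_cong[OF DERIV_diff[OF DERIV_const assms(2)[unfolded log_deriv_def]]]) (simp add: assms(4))
  show "((\<lambda>q. 1 - h q) has_field_derivative - (b * f x / x)) (at x)"
    by (rule DERIV_cong[OF DERIV_diff[OF DERIV_const assms(3)[unfolded log_deriv_def]]]) (simp add: assms(5))
qed (simp_all add: assms(4,5))

lemma one_minus_power_DERIV:
  assumes "log_deriv x f a"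
  shows "((\<lambda>q. (1 - f q) ^ Suc k) has_field_derivative - (of_nat (Suc k) * a) * ((1 - f x) ^ k * f x / x)) (at x)"
  by (rule DERIV_cong[OF DERIV_power[OF DERIV_diff[OF DERIV_const assms[unfolded log_deriv_def]]]]) simp

text \<open>As all parameters agree at \<open>x\<close>, the derivative of the product depends only
  on the total exponent B + dA. Parameters may therefore be redistributed as long as this total is
  kept. The factors are allowed to vanish at \<open>x\<close>, as the factor 1 - q Q^N does at roots
  of order \<open>n\<close>.\<close>

lemma deriv_split_factor:
  assumes "log_deriv x b B" "log_deriv x a A" "log_deriv x g C" "log_deriv x h E"
    and "a x = b x" "g x = b x" "h x = b x"
    and "B + of_nat d * A = of_nat (Suc d) * C + of_nat (Suc d) * E"
  shows "deriv_split x (\<lambda>q. (1 - b q) * (1 - a q) ^ d) (\<lambda>q. (1 - g q) ^ Suc d) (\<lambda>q. (1 - h q) ^ Suc d)"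
proof -
  let ?c = "(1 - b x) ^ d * b x / x"
  have *: "((\<lambda>q. (1 - b q) * (1 - a q) ^ d) has_field_derivative - (B + of_nat d * A) * ?c) (at x)"
  proof (cases d)
    case 0
    then show ?thesis
      using DERIV_diff[OF DERIV_const assms(1)[unfolded log_deriv_def], of 1] by simp
  next
    case (Suc d')
    show ?thesis
      unfolding Suc
      by (rule DERIV_cong[OF DERIV_mult[OF DERIV_diff[OF DERIV_const assms(1)[unfolded log_deriv_def]] one_minus_power_DERIV[OF assms(2)]]])
         (simp add: assms(5) divide_inverse algebra_simps)
  qed
  show ?thesis
    unfolding deriv_split_def
  proof (intro conjI exI)
    show "((\<lambda>q. (1 - b q) * (1 - a q) ^ d) has_field_derivative
        - (of_nat (Suc d) * C) * ?c + - (of_nat (Suc d) * E) * ?c) (at x)"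
      by (rule DERIV_cong[OF *]) (simp only: assms(8) minus_add_distrib distrib_right)
    show "((\<lambda>q. (1 - g q) ^ Suc d) has_field_derivative - (of_nat (Suc d) * C) * ?c) (at x)"
      using one_minus_power_DERIV[OF assms(3), of d] by (simp only: assms(6))
    show "((\<lambda>q. (1 - h q) ^ Suc d) has_field_derivative - (of_nat (Suc d) * E) * ?c) (at x)"
      using one_minus_power_DERIV[OF assms(4), of d] by (simp only: assms(7))
  qed (simp_all add: assms(5-7))
qed

text \<open>Variation of the base \<open>Q\<close> adds the same exponent to all d + 1 factors. It
  is assigned entirely to \<open>g\<close>, which is why \<open>h\<close> has the base frozen at
  \<open>Q x\<close>.\<close>

lemma deriv_split_qfac:
  assumes "log_deriv x b B" "log_deriv x a A" "log_deriv x g C" "log_deriv x h E" "log_deriv x Q K"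
    and "a x = b x" "g x = b x" "h x = b x"
    and "B + of_nat d * A = of_nat (Suc d) * C + of_nat (Suc d) * E"
  shows "deriv_split x (\<lambda>q. qfac (b q) (Q q) k * qfac (a q) (Q q) k ^ d) (\<lambda>q. qfac (g q) (Q q) k ^ Suc d) (\<lambda>q. qfac (h q) (Q x) k ^ Suc d)"
proof -
  have "deriv_split x (\<lambda>q. \<Prod>i<k. (1 - b q * Q q ^ i) * (1 - a q * Q q ^ i) ^ d)
      (\<lambda>q. \<Prod>i<k. (1 - g q * Q q ^ i) ^ Suc d) (\<lambda>q. \<Prod>i<k. (1 - h q * Q x ^ i) ^ Suc d)"
  proof (intro deriv_split_prod deriv_split_factor)
    fix i
    show "log_deriv x (\<lambda>q. b q * Q q ^ i) (B + of_nat i * K)"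
      "log_deriv x (\<lambda>q. a q * Q q ^ i) (A + of_nat i * K)"
      "log_deriv x (\<lambda>q. g q * Q q ^ i) (C + of_nat i * K)"
      "log_deriv x (\<lambda>q. h q * Q x ^ i) (E + 0)"
      by (intro log_deriv_mult log_deriv_power log_deriv_const assms(1-5))+
    have "B + of_nat i * K + of_nat d * (A + of_nat i * K)
       = (B + of_nat d * A) + of_nat (Suc d) * (of_nat i * K)"
      by (simp add: algebra_simps)
    then show "B + of_nat i * K + of_nat d * (A + of_nat i * K)
       = of_nat (Suc d) * (C + of_nat i * K) + of_nat (Suc d) * (E + 0)"
      unfolding assms(9) by (simp add: algebra_simps)
  qed (simp_all add: assms(6-8))
  then show ?thesis
    by (simp only: qfac_def prod_power_distrib prod.distrib)
qed

text \<open>The derivatives of \<open>f\<close> and \<open>h\<close> at \<open>x\<close> are both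
  zero, and that of \<open>g\<close> is their difference. This transfers a double zero from the
  modified sums to the original one.\<close>

lemma deriv_split_zero:
  assumes "deriv_split x f g h" "eventually (\<lambda>q. f q = 0) (nhds x)" "eventually (\<lambda>q. h q = 0) (nhds x)"
  shows "g x = 0 \<and> (g has_field_derivative 0) (at x)"
proof -
  obtain D E where *: "(f has_field_derivative D + E) (at x)" "(g has_field_derivative D) (at x)"
      "(h has_field_derivative E) (at x)" and "g x = f x"
    using assms unfolding deriv_split_def by blast
  have "(f has_field_derivative 0) (at x)" "(h has_field_derivative 0) (at x)"
    using DERIV_cong_ev[OF refl assms(2) refl, of 0] DERIV_cong_ev[OF refl assms(3) refl, of 0] by auto
  then have "D + E = 0" "E = 0"
    using * DERIV_unique by blast+
  moreover have "f x = 0"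
    using assms(2) by (rule eventually_nhds_x_imp_x)
  ultimately show ?thesis
    using *(2) \<open>g x = f x\<close> by simp
qed

lemma eventually_nonzero_nhds:
  fixes f :: "'a::t2_space \<Rightarrow> 'b::t1_space"
  assumes "isCont f x" "f x \<noteq> c"
  shows "eventually (\<lambda>q. f q \<noteq> c) (nhds x)"
proof -
  have "(f \<longlongrightarrow> f x) (nhds x)"
    using assms(1) by (simp add: isCont_def tendsto_at_iff_tendsto_nhds)
  then show ?thesis
    using assms(2) by (rule tendsto_imp_eventually_ne)
qed

section \<open>The double zero at primitive roots of order n\<close>

definition vwp_sum :: "nat \<Rightarrow> nat \<Rightarrow> 'a::field \<Rightarrow> 'a" where
  "vwp_sum d n q = (\<Sum>k<n. (1 - q * (q ^ d) ^ (2 * k)) * (qfac q (q ^ d) k ^ d / qfac (q ^ d) (q ^ d) k ^ d)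
     * q ^ (d * (d - 3) * k div 2))"

text \<open>\<open>vwp_sum\<close> is 1 - q times the sum of the theorem. It takes the role of
  \<open>g\<close> in \<open>deriv_split_zero\<close>; \<open>f\<close> is the modified sum
  \<open>T\<close>, zero near \<open>x\<close>, and \<open>h\<close> is a correction
  \<open>W\<close>, constant for odd \<open>d\<close> and a shift of the argument for even
  \<open>d\<close>.\<close>

lemma vwp_sum_double_zero:
  fixes x :: complex
  assumes "d \<ge> 4" "d * m = n + 1" "\<And>j. x ^ j = 1 \<longleftrightarrow> n dvd j"
  shows "vwp_sum d n x = 0 \<and> (vwp_sum d n has_field_derivative 0) (at x)"
proof -
  have "m > 0" using assms(2) by (cases m) auto
  have "4 * m \<le> d * m" using assms(1) by simp
  then have "m \<le> n" "n > 0" "n \<ge> 3" using assms(2) \<open>m > 0\<close> by linarith+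
  have "x \<noteq> 0" using assms(3)[of n] \<open>n > 0\<close> by (auto simp: zero_power)
  have "coprime n d"
  proof (rule coprimeI)
    fix c assume "c dvd n" "c dvd d"
    then have "c dvd d * m" by simp
    with \<open>c dvd n\<close> show "c dvd 1" unfolding assms(2) using dvd_add_right_iff by blast
  qed
  have xm: "x ^ (d * m) = x" using assms(3)[of n] by (simp add: assms(2))
  define N where "N = n - m"
  have Nm: "N + m = n" using \<open>m \<le> n\<close> by (simp add: N_def)
  have xN: "x ^ (d * N) * x = 1"
  proof -
    have "x ^ (d * N) * x ^ (d * m) = x ^ (n * d)"
      unfolding power_add [symmetric] add_mult_distrib2 [symmetric] Nm by (simp add: mult.commute)
    then show ?thesis using assms(3)[of "n * d"] xm by simp
  qed
  have xNinv: "inverse (x ^ (d * N)) = x"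
    using xN by (rule inverse_unique)
  \<comment> \<open>Since \<open>d\<close> is prime to \<open>n\<close>, x^d has order
    \<open>n\<close> as well, so no denominator vanishes at \<open>x\<close>.\<close>
  have ne1: "(x ^ d) ^ i \<noteq> 1" if "0 < i" "i < n" for i
  proof
    assume "(x ^ d) ^ i = 1"
    then have "n dvd d * i" using assms(3) by (simp flip: power_mult)
    then have "n dvd i" using \<open>coprime n d\<close> coprime_dvd_mult_right_iff by blast
    with that show False by (auto dest: dvd_imp_le)
  qed
  have nz: "qfac (x ^ d) (x ^ d) k \<noteq> 0" if "k < n" for k
    using ne1[of "Suc _"] that by (fastforce simp: qfac_eq_0_iff)
  have log_deriv_pow: "log_deriv x (\<lambda>q. q ^ k) (of_nat k)" for k
    using log_deriv_power[OF log_deriv_ident[OF \<open>x \<noteq> 0\<close>], of k] by simp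
  have log_deriv_pow2: "log_deriv x (\<lambda>q. (q ^ d) ^ k) (of_nat k * of_nat d)" for k
    by (intro log_deriv_power log_deriv_pow)
  define E where "E k = d * (d - 3) * k div 2" for k
  \<comment> \<open>The relations dN = (d-1)n - 1 and dm = n + 1 are the inputs for all the exponent
    balances below.\<close>
  have dN: "of_nat d * of_nat N = (of_nat d * of_nat n - of_nat n - 1 :: complex)"
  proof -
    have "d * N + (n + 1) = d * n"
      unfolding assms(2) [symmetric] add_mult_distrib2 [symmetric] Nm ..
    then have "of_nat (d * N + (n + 1)) = (of_nat (d * n) :: complex)" by simp
    then show ?thesis by (simp add: algebra_simps)
  qed
  have dm: "of_nat d * of_nat m = (of_nat n + 1 :: complex)"
    using arg_cong[OF assms(2), of "of_nat :: nat \<Rightarrow> complex"] by (simp add: add.commute)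
  obtain d' where d': "d = Suc d'" using assms(1) by (cases d) auto
  have cd: "of_nat d = (of_nat d' + 1 :: complex)"
    by (simp add: d')
  define S where "S k q = (1 - q * (q ^ d) ^ (2 * k)) * (qfac q (q ^ d) k ^ Suc d' / qfac (q ^ d) (q ^ d) k ^ Suc d') * q ^ E k"
    for k and q :: complex
  have vwp: "vwp_sum d n = (\<lambda>q. \<Sum>k<n. S k q)"
    unfolding vwp_sum_def S_def E_def d' ..
  have logdN: "log_deriv x (\<lambda>q. inverse ((q ^ d) ^ N)) (- (of_nat N * of_nat d))"
    using \<open>x \<noteq> 0\<close> by (intro log_deriv_inverse log_deriv_pow2) auto
  have xN': "inverse ((x ^ d) ^ N) = x" and xm': "(x ^ d) ^ m = x"
    using xNinv xm by (simp_all add: power_mult)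
  show ?thesis
  proof (cases "even d")
    case False
    then obtain e where e: "d = 2 * e + 1" by (elim oddE)
    then have "e \<ge> 2" using assms(1) by simp
    define T where "T k q = (1 - q * (q ^ d) ^ (2 * k)) * (qfac (inverse ((q ^ d) ^ N)) (q ^ d) k * qfac ((q ^ d) ^ m) (q ^ d) k ^ d'
       / (qfac (q ^ d) (q ^ d) k * qfac (q ^ d) (q ^ d) k ^ d')) * q ^ E k" for k and q :: complex
    have Ek: "q ^ E k = (q ^ d) ^ ((e - 1) * k)" for k and q :: complex
    proof -
      obtain f where f: "e = Suc (Suc f)" using \<open>e \<ge> 2\<close> by (metis add_2_eq_Suc le_Suc_ex)
      have "d * (d - 3) * k = 2 * (d * ((e - 1) * k))" by (simp add: e f algebra_simps)
      then have "E k = d * ((e - 1) * k)" by (simp only: E_def nonzero_mult_div_cancel_left)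
      then show ?thesis by (simp only: power_mult)
    qed
    have T0: "(\<Sum>k<n. T k q) = 0" if "q \<noteq> 0" "qfac (q ^ d) (q ^ d) (n - 1) \<noteq> 0" for q
    proof -
      have "q ^ d \<noteq> 0" using that by simp
      have "2 * e = d'" using d' e by simp
      from odd_sum_eq_0[OF \<open>e \<ge> 2\<close> assms(2)[unfolded e] \<open>q ^ d \<noteq> 0\<close> that(2), of q, unfolded this Ek [symmetric] N_def [symmetric]]
      show ?thesis
        by (simp only: T_def times_divide_eq_right)
    qed
    define W where "W k = (1 - x * (x ^ d) ^ (2 * k)) * (qfac x (x ^ d) k ^ Suc d' / qfac (x ^ d) (x ^ d) k ^ Suc d') * x ^ E k" for k
    have split: "deriv_split x (T k) (S k) (\<lambda>_. W k)" if "k < n" for k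
    proof -
      have 1: "deriv_split x (\<lambda>q. 1 - q * (q ^ d) ^ (2 * k)) (\<lambda>q. 1 - q * (q ^ d) ^ (2 * k)) (\<lambda>_. 1 - x * (x ^ d) ^ (2 * k))"
        using log_deriv_mult[OF log_deriv_ident[OF \<open>x \<noteq> 0\<close>] log_deriv_pow2[of "2 * k"]]
        by (intro deriv_split_one_minus[OF _ _ log_deriv_const]) simp_all
      have 2: "deriv_split x (\<lambda>q. qfac (inverse ((q ^ d) ^ N)) (q ^ d) k * qfac ((q ^ d) ^ m) (q ^ d) k ^ d')
          (\<lambda>q. qfac q (q ^ d) k ^ Suc d') (\<lambda>_. qfac x (x ^ d) k ^ Suc d')"
      proof (rule deriv_split_qfac[OF logdN log_deriv_pow2 log_deriv_ident[OF \<open>x \<noteq> 0\<close>] log_deriv_const log_deriv_pow])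
        \<comment> \<open>The exponents of Q^(-N) and of d - 1 copies of Q^m add up to
          \<open>d\<close>, exactly the total of \<open>d\<close> copies of \<open>q\<close>, so no
          correction is required.\<close>
        show "- (of_nat N * of_nat d) + of_nat d' * (of_nat m * of_nat d) =
            of_nat (Suc d') * 1 + of_nat (Suc d') * (0 :: complex)"
          unfolding d' [symmetric] using dN dm cd by algebra
      qed (simp_all add: xN' xm')
      have 3: "deriv_split x (\<lambda>q. qfac (q ^ d) (q ^ d) k * qfac (q ^ d) (q ^ d) k ^ d')
          (\<lambda>q. qfac (q ^ d) (q ^ d) k ^ Suc d') (\<lambda>_. qfac (x ^ d) (x ^ d) k ^ Suc d')"
        by (rule deriv_split_qfac[OF log_deriv_pow log_deriv_pow log_deriv_pow log_deriv_const log_deriv_pow]) (simp_all add: algebra_simps)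
      show ?thesis
        unfolding T_def S_def W_def
        using nz[OF that] by (intro deriv_split_mult deriv_split_divide 1 2 3 deriv_split_same[OF log_deriv_pow]) simp
    qed
    have ev: "\<forall>\<^sub>F q in nhds x. q * qfac (q ^ d) (q ^ d) (n - 1) \<noteq> 0"
      using nz[of "n - 1"] \<open>n > 0\<close> \<open>x \<noteq> 0\<close>
      by (intro eventually_nonzero_nhds) (auto simp: qfac_def intro!: continuous_intros)
    have split_all: "deriv_split x (\<lambda>q. \<Sum>k<n. T k q) (vwp_sum d n) (\<lambda>_. \<Sum>k<n. W k)"
      unfolding vwp by (intro deriv_split_sum split)
    have evT: "\<forall>\<^sub>F q in nhds x. (\<Sum>k<n. T k q) = 0"
      using ev by (rule eventually_mono) (auto intro: T0)
    then have "(\<Sum>k<n. T k x) = 0" by (rule eventually_nhds_x_imp_x)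
    \<comment> \<open>The correction has the same value at \<open>x\<close> as \<open>T\<close>,
      namely 0; being constant, it vanishes identically.\<close>
    with split_all have "(\<Sum>k<n. W k) = 0" by (simp add: deriv_split_def)
    then show ?thesis
      using split_all evT by (intro deriv_split_zero[OF split_all evT]) simp
  next
    case True
    then obtain e where e: "d = 2 * e" by (elim evenE)
    then have "e \<ge> 2" using assms(1) by simp
    have d'e: "2 * e - 1 = d'" "2 * e = Suc d'" using d' e by simp_all
    have ce: "2 * of_nat e = (of_nat d :: complex)" by (simp add: e)
    have pw: "(q ^ e)\<^sup>2 = q ^ d" for q :: complex
      unfolding e by (simp add: mult.commute flip: power_mult)
    have Ek: "q ^ E k = (q ^ e) ^ ((2 * e - 3) * k)" for k and q :: complex
    proof -
      have "d * (d - 3) * k = 2 * (e * ((2 * e - 3) * k))" by (simp add: e)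
      then have "E k = e * ((2 * e - 3) * k)" by (simp only: E_def nonzero_mult_div_cancel_left)
      then show ?thesis by (simp only: power_mult)
    qed
    have m2: "2 * e * m = n + 1" using assms(2) e by simp
    define l where "l q = inverse ((q ^ e) ^ n)" for q :: complex
    have l: "log_deriv x l (- (of_nat n * of_nat e))"
      unfolding l_def using \<open>x \<noteq> 0\<close> by (intro log_deriv_inverse log_deriv_power log_deriv_pow) auto
    have lx: "l x = 1"
      using assms(3)[of "e * n"] by (simp add: l_def flip: power_mult)
    define r :: complex where "r = - (of_nat n * (of_nat d - 1)) / 2"
    have r: "2 * r = - (of_nat n * (of_nat d - 1))" by (simp add: r_def)
    \<comment> \<open>\<open>r\<close> is chosen so that the exponents in the three comparisons below add up.\<close>
    define \<mu> where "\<mu> q = 1 + r * (q - x) / x" for q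
    have \<mu>x: "\<mu> x = 1" by (simp add: \<mu>_def)
    \<comment> \<open>Only the value 1 and the logarithmic derivative \<open>r\<close> at
      \<open>x\<close> matter. An affine function realises them, whereas q^r would need a branch
      because \<open>r\<close> is half an odd integer.\<close>
    have \<mu>: "log_deriv x \<mu> r"
      unfolding log_deriv_def \<mu>_def using \<open>x \<noteq> 0\<close> by (auto intro!: derivative_eq_intros)
    define T where "T k q = (1 - (q ^ d) ^ (2 * k) * inverse ((q ^ d) ^ N))
       * (qfac (inverse ((q ^ d) ^ N)) (q ^ d) k * qfac (l q * (q ^ d) ^ m) (q ^ d) k ^ d'
       / (qfac (q ^ d) (q ^ d) k * qfac (l q * q ^ d) (q ^ d) k ^ d')) * q ^ E k" for k and q :: complex
    have T0: "(\<Sum>k<n. T k q) = 0"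
      if "q \<noteq> 0" "qfac (q ^ d) (q ^ d) (n - 1) \<noteq> 0" "qfac (l q * q ^ d) (q ^ d) (n - 1) \<noteq> 0" for q
    proof -
      have "q ^ e \<noteq> 0" using that by simp
      from even_sum_eq_0[OF \<open>e \<ge> 2\<close> m2 this, unfolded pw l_def [symmetric] N_def [symmetric] Ek [symmetric] d'e(1), OF that(2,3)]
      show ?thesis
        by (simp only: T_def times_divide_eq_right)
    qed
    \<comment> \<open>Base and monomial factor are frozen at \<open>x\<close>; \<open>q\<close>
      enters only through \<mu>, which matches the form of
      \<open>shifted_sum_monomial\<close>.\<close>
    define W where "W k q = (1 - (\<mu> q)\<^sup>2 * x * (x ^ d) ^ (2 * k)) * (qfac (\<mu> q * x) (x ^ d) k ^ Suc d' / qfac (\<mu> q * x ^ d) (x ^ d) k ^ Suc d') * x ^ E k" for k q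
    have split: "deriv_split x (T k) (S k) (W k)" if "k < n" for k
    proof -
      have 1: "deriv_split x (\<lambda>q. 1 - (q ^ d) ^ (2 * k) * inverse ((q ^ d) ^ N)) (\<lambda>q. 1 - q * (q ^ d) ^ (2 * k)) (\<lambda>q. 1 - (\<mu> q)\<^sup>2 * x * (x ^ d) ^ (2 * k))"
      proof (rule deriv_split_one_minus)
        show "log_deriv x (\<lambda>q. q * (q ^ d) ^ (2 * k)) (1 + of_nat (2 * k) * of_nat d)"
          by (intro log_deriv_mult log_deriv_ident log_deriv_pow2 \<open>x \<noteq> 0\<close>)
        show "log_deriv x (\<lambda>q. (\<mu> q)\<^sup>2 * x * (x ^ d) ^ (2 * k)) (of_nat 2 * r + 0 + 0)"
          by (intro log_deriv_mult log_deriv_power log_deriv_const \<mu>)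
        have "of_nat (2 * k) * of_nat d + - (of_nat N * of_nat d) = 1 + of_nat (2 * k) * of_nat d + (of_nat 2 * r + 0 + 0)"
          unfolding of_nat_numeral using dN r by algebra
        then show "log_deriv x (\<lambda>q. (q ^ d) ^ (2 * k) * inverse ((q ^ d) ^ N)) (1 + of_nat (2 * k) * of_nat d + (of_nat 2 * r + 0 + 0))"
          using log_deriv_mult[OF log_deriv_pow2[of "2 * k"] logdN] by (simp only:)
      qed (simp_all add: \<mu>x xN')
      have 2: "deriv_split x (\<lambda>q. qfac (inverse ((q ^ d) ^ N)) (q ^ d) k * qfac (l q * (q ^ d) ^ m) (q ^ d) k ^ d')
          (\<lambda>q. qfac q (q ^ d) k ^ Suc d') (\<lambda>q. qfac (\<mu> q * x) (x ^ d) k ^ Suc d')"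
      proof (rule deriv_split_qfac[OF logdN log_deriv_mult[OF l log_deriv_pow2] log_deriv_ident[OF \<open>x \<noteq> 0\<close>] log_deriv_mult[OF \<mu> log_deriv_const] log_deriv_pow])
        show "- (of_nat N * of_nat d) + of_nat d' * (- (of_nat n * of_nat e) + of_nat m * of_nat d)
          = of_nat (Suc d') * 1 + of_nat (Suc d') * (r + 0)"
          unfolding d' [symmetric] using dN dm cd ce r by algebra
      qed (simp_all add: xN' xm' lx \<mu>x)
      have 3: "deriv_split x (\<lambda>q. qfac (q ^ d) (q ^ d) k * qfac (l q * q ^ d) (q ^ d) k ^ d')
          (\<lambda>q. qfac (q ^ d) (q ^ d) k ^ Suc d') (\<lambda>q. qfac (\<mu> q * x ^ d) (x ^ d) k ^ Suc d')"
      proof (rule deriv_split_qfac[OF log_deriv_pow log_deriv_mult[OF l log_deriv_pow] log_deriv_pow log_deriv_mult[OF \<mu> log_deriv_const] log_deriv_pow])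
        show "of_nat d + of_nat d' * (- (of_nat n * of_nat e) + of_nat d)
          = of_nat (Suc d') * of_nat d + of_nat (Suc d') * (r + 0)"
          unfolding d' [symmetric] using cd ce r by algebra
      qed (simp_all add: lx \<mu>x)
      show ?thesis
        unfolding T_def S_def W_def
        using nz[OF that] by (intro deriv_split_mult deriv_split_divide 1 2 3 deriv_split_same[OF log_deriv_pow]) (simp add: lx)
    qed
    have split_all: "deriv_split x (\<lambda>q. \<Sum>k<n. T k q) (vwp_sum d n) (\<lambda>q. \<Sum>k<n. W k q)"
      unfolding vwp by (intro deriv_split_sum split)
    have nz1: "qfac (x ^ d) (x ^ d) (n - 1) \<noteq> 0" using nz \<open>n > 0\<close> by simp
    have contl: "isCont l x" using l unfolding log_deriv_def by (rule DERIV_isCont)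
    have cont\<mu>: "isCont \<mu> x" using \<mu> unfolding log_deriv_def by (rule DERIV_isCont)
    have ev: "\<forall>\<^sub>F q in nhds x. q * qfac (q ^ d) (q ^ d) (n - 1) * qfac (l q * q ^ d) (q ^ d) (n - 1) \<noteq> 0"
    proof (rule eventually_nonzero_nhds)
      show "isCont (\<lambda>q. q * qfac (q ^ d) (q ^ d) (n - 1) * qfac (l q * q ^ d) (q ^ d) (n - 1)) x"
        unfolding qfac_def using contl by (intro continuous_intros) 
    qed (use nz1 \<open>x \<noteq> 0\<close> in \<open>simp add: lx\<close>)
    have evT: "\<forall>\<^sub>F q in nhds x. (\<Sum>k<n. T k q) = 0"
      using ev by (rule eventually_mono) (auto intro: T0)
    then have "(\<Sum>k<n. T k x) = 0" by (rule eventually_nhds_x_imp_x)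
    with split_all have W1: "(\<Sum>k<n. W k x) = 0" by (simp add: deriv_split_def)
    have "coprime n e" using \<open>coprime n d\<close> by (simp add: e)
    \<comment> \<open>The half-power x^e, which serves as \<open>p\<close>, still has exact order
      \<open>n\<close>.\<close>
    then have xe: "(x ^ e) ^ j = 1 \<longleftrightarrow> n dvd j" for j
      using assms(3)[of "e * j"] by (simp add: power_mult coprime_dvd_mult_right_iff)
    obtain h J where hJ: "\<forall>\<nu>. qfac (\<nu> * x ^ d) (x ^ d) (n - 1) \<noteq> 0 \<longrightarrow>
        qfac (\<nu> * x ^ d) (x ^ d) (m - 1) ^ Suc d' *
        (\<Sum>k<n. (1 - \<nu>\<^sup>2 * x * (x ^ d) ^ (2 * k)) * (qfac (\<nu> * x) (x ^ d) k / qfac (\<nu> * x ^ d) (x ^ d) k) ^ Suc d' * x ^ E k)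
        = h * \<nu> ^ J"
      using shifted_sum_monomial[OF \<open>e \<ge> 2\<close> m2 xe, unfolded pw xm' Ek [symmetric], unfolded d'e(2)]
      by (elim exE)
    have W: "qfac (\<mu> q * x ^ d) (x ^ d) (m - 1) ^ Suc d' * (\<Sum>k<n. W k q) = h * \<mu> q ^ J"
      if "qfac (\<mu> q * x ^ d) (x ^ d) (n - 1) \<noteq> 0" for q
      using mp[OF spec[OF hJ] that] by (simp only: W_def power_divide)
    \<comment> \<open>At q = x one has \<mu> = 1, and the sum of \<open>W\<close> there is already
      known to be 0. This determines the coefficient of the single monomial.\<close>
    have "h = 0"
      using W[of x] nz1 by (simp add: W1 \<mu>x)
    have ev\<mu>: "\<forall>\<^sub>F q in nhds x. qfac (\<mu> q * x ^ d) (x ^ d) (n - 1) \<noteq> 0"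
    proof (rule eventually_nonzero_nhds)
      show "isCont (\<lambda>q. qfac (\<mu> q * x ^ d) (x ^ d) (n - 1)) x"
        unfolding qfac_def using cont\<mu> by (intro continuous_intros)
    qed (use nz1 in \<open>simp add: \<mu>x\<close>)
    have evW: "\<forall>\<^sub>F q in nhds x. (\<Sum>k<n. W k q) = 0"
      using ev\<mu>
    proof (rule eventually_mono)
      fix q assume q: "qfac (\<mu> q * x ^ d) (x ^ d) (n - 1) \<noteq> 0"
      then have "qfac (\<mu> q * x ^ d) (x ^ d) (m - 1) \<noteq> 0"
        using \<open>m \<le> n\<close> by (auto simp: qfac_eq_0_iff)
      then show "(\<Sum>k<n. W k q) = 0"
        using W[OF q] \<open>h = 0\<close> by simp
    qed
    show ?thesis
      by (rule deriv_split_zero[OF split_all evT evW])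
  qed
qed

section \<open>From complex zeros to polynomial divisibility\<close>

definition primitive_roots :: "nat \<Rightarrow> complex set" where
  "primitive_roots m = (\<lambda>k. cis (2 * pi * real k / real m)) ` {k. 1 \<le> k \<and> k \<le> m \<and> coprime k m}"

lemma cis_root_eq_1_iff:
  assumes "m > 0"
  shows "cis (2 * pi * real k / real m) = 1 \<longleftrightarrow> m dvd k"
proof
  assume "cis (2 * pi * real k / real m) = 1"
  then obtain z where "2 * pi * real k / real m = of_int z * (2 * pi)"
    by (auto simp: cis_eq_1_iff)
  then have "real k = of_int z * real m"
    using assms by (simp add: field_simps)
  then have "int k = z * int m"
    by (metis of_int_eq_iff of_int_mult of_int_of_nat_eq)
  then have "int m dvd int k" by simp
  then show "m dvd k" by (simp only: int_dvd_int_iff)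
next
  assume "m dvd k"
  then obtain j where "k = m * j" ..
  then have "2 * pi * real k / real m = of_int (int j) * (2 * pi)"
    using assms by simp
  then show "cis (2 * pi * real k / real m) = 1"
    unfolding cis_eq_1_iff by blast
qed

lemma primitive_roots_power_eq_1_iff:
  assumes "x \<in> primitive_roots m" "m > 0"
  shows "x ^ j = 1 \<longleftrightarrow> m dvd j"
proof -
  from assms(1) obtain k where k: "x = cis (2 * pi * real k / real m)" "coprime k m"
    unfolding primitive_roots_def by auto
  have "x ^ j = cis (2 * pi * real (j * k) / real m)"
    unfolding k(1) DeMoivre by (simp add: mult_ac)
  then have "x ^ j = 1 \<longleftrightarrow> m dvd j * k"
    by (simp only: cis_root_eq_1_iff[OF assms(2)])
  then show ?thesis
    using k(2) by (simp add: coprime_commute coprime_dvd_mult_left_iff)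
qed

lemma finite_primitive_roots: "finite (primitive_roots m)"
proof -
  have "finite {k. 1 \<le> k \<and> k \<le> m \<and> coprime k m}"
    by (rule finite_subset[of _ "{..m}"]) auto
  then show ?thesis by (simp add: primitive_roots_def)
qed

text \<open>The indexing by exponents is injective: equal roots for j < k would make
  \<open>m\<close> divide k - j, which lies strictly between 0 and \<open>m\<close>.\<close>

lemma cyclotomic_eq_prod:
  assumes "m > 0"
  shows "cyclotomic m = (\<Prod>x\<in>primitive_roots m. [:- x, 1:])"
proof -
  have less: False if "j < k" "1 \<le> j" "k \<le> m" "cis (2 * pi * real j / real m) = cis (2 * pi * real k / real m)" for j k
  proof -
    have "cis (2 * pi * real (k - j) / real m) = cis (2 * pi * real k / real m) / cis (2 * pi * real j / real m)"
    proof -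
      have "2 * pi * real (k - j) / real m = 2 * pi * real k / real m - 2 * pi * real j / real m"
        using that(1) by (simp add: of_nat_diff algebra_simps diff_divide_distrib)
      then show ?thesis by (simp only: cis_divide)
    qed
    also have "\<dots> = 1" using that(4) by simp
    finally have "m dvd k - j" by (simp add: cis_root_eq_1_iff[OF assms])
    then show False using that by (auto dest: dvd_imp_le)
  qed
  have "inj_on (\<lambda>k. cis (2 * pi * real k / real m)) {k. 1 \<le> k \<and> k \<le> m \<and> coprime k m}"
    by (rule inj_onI) (metis (mono_tags, lifting) less linorder_neqE_nat mem_Collect_eq)
  then show ?thesis
    unfolding cyclotomic_def primitive_roots_def by (subst prod.reindex) simp_all
qed

text \<open>Linear factors at distinct points are coprime: the product over the other points has
  order 0 at \<open>a\<close>, so the whole power at \<open>a\<close> divides the cofactor.\<close>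

lemma prod_linear_power_dvd:
  fixes A :: "'a::idom poly"
  assumes "finite S" "\<And>a. a \<in> S \<Longrightarrow> [:- a, 1:] ^ k a dvd A"
  shows "(\<Prod>a\<in>S. [:- a, 1:] ^ k a) dvd A"
  using assms
proof (induction S rule: finite_induct)
  case (insert a S)
  then obtain R where R: "A = (\<Prod>a\<in>S. [:- a, 1:] ^ k a) * R"
    by (auto elim: dvdE)
  have "poly (\<Prod>a\<in>S. [:- a, 1:] ^ k a) a \<noteq> 0"
    using insert.hyps by (auto simp: poly_prod)
  moreover from this have "(\<Prod>a\<in>S. [:- a, 1:] ^ k a) \<noteq> 0"
    by auto
  ultimately have P: "order a (\<Prod>a\<in>S. [:- a, 1:] ^ k a) = 0" "(\<Prod>a\<in>S. [:- a, 1:] ^ k a) \<noteq> 0"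
    by (simp_all add: order_0I)
  from P have "A \<noteq> 0 \<Longrightarrow> order a R = order a A"
    unfolding R by (simp add: order_mult)
  moreover have "[:- a, 1:] ^ k a dvd A"
    using insert.prems by simp
  ultimately have "[:- a, 1:] ^ k a dvd R"
    using R P(2) by (cases "A = 0") (auto simp: order_divides)
  then show ?case
    using insert.hyps by (simp add: R mult_dvd_mono mult.commute)
qed simp

lemma linear_square_dvd:
  fixes A :: "'a::field poly"
  assumes "poly A x = 0" "poly (pderiv A) x = 0"
  shows "[:- x, 1:]\<^sup>2 dvd A"
proof -
  obtain R where R: "A = [:- x, 1:] * R"
    using assms(1) by (auto simp: poly_eq_0_iff_dvd elim: dvdE)
  have "[:- x, 1:] dvd R"
    unfolding poly_eq_0_iff_dvd [symmetric]
    using assms(2) by (simp add: R pderiv_mult pderiv_pCons del: mult_pCons_left)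
  then show ?thesis
    unfolding R power2_eq_square by (intro mult_dvd_mono dvd_refl)
qed

section \<open>Common denominators and the congruence\<close>

lemma coprime_linear:
  fixes B :: "complex poly"
  assumes "poly B x \<noteq> 0"
  shows "coprime B [:- x, 1:]"
proof -
  have "coprime [:- x, 1:] B"
    using assms by (intro prime_elem_imp_coprime prime_elem_linear_field_poly) (simp_all add: poly_eq_0_iff_dvd)
  then show ?thesis by (simp add: coprime_commute)
qed

lemma rf_simps: "rf 0 = 0" "rf 1 = 1" "rf (p + q) = rf p + rf q" "rf (p * q) = rf p * rf q" "rf p = 0 \<longleftrightarrow> p = 0"
  by (simp_all add: rf_def Zero_fract_def One_fract_def eq_fract)

lemma rf_power: "rf (p ^ k) = rf p ^ k"
  by (induction k) (simp_all add: rf_simps)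

lemma rf_sum: "rf (sum f S) = (\<Sum>k\<in>S. rf (f k))"
  by (induction S rule: infinite_finite_induct) (simp_all add: rf_simps)

lemma Fract_eq_rf_divide: "Fract p q = rf p / rf q"
  by (simp add: rf_def)

lemma qpoch_eq_qfac: "qpoch a b k = qfac a b k"
  by (simp add: qpoch_def qfac_def)

lemma poly_qfac_eq: "poly (qfac a b k) y = qfac (poly a y) (poly b y) k"
  by (simp add: qfac_def poly_prod)

theorem theorem4:
  fixes d n :: nat
  assumes "d \<ge> 4" and "n > 0" and "(int n + 1) mod int d = 0"
  shows "rf_cong
    (\<Sum>k<n. qint (2*d*k + 1)
        * rf (qpoch qvar (qvar ^ d) k) ^ d / rf (qpoch (qvar ^ d) (qvar ^ d) k) ^ d
        * rf (qvar ^ (d * (d - 3) * k div 2)))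
    0
    ((cyclotomic n)\<^sup>2 * cyclotomic (d * n - n))"
proof -
  have "int d dvd int (n + 1)" using assms(3) by (simp add: mod_eq_0_iff_dvd add.commute)
  then have "d dvd n + 1" by (simp only: int_dvd_int_iff)
  then obtain m where m: "d * m = n + 1" by (metis dvdE)
  define M where "M = d * n - n"
  have "3 * n \<le> (d - 1) * n" using assms(1) by (intro mult_right_mono) auto
  then have M: "M \<ge> 3 * n" by (simp add: M_def diff_mult_distrib)
  have "n \<ge> 3" using \<open>d dvd n + 1\<close> assms(1) by (auto dest: dvd_imp_le)
  have copM: "coprime M d"
  proof (rule coprimeI)
    fix c assume c: "c dvd M" "c dvd d"
    have "n = d * n - M" using assms(1) by (simp add: M_def)
    then have "c dvd n" using c by (metis dvd_diff_nat dvd_mult2)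
    moreover have "c dvd n + 1" unfolding m [symmetric] using c(2) by simp
    ultimately show "c dvd 1" by (metis dvd_add_right_iff)
  qed
  have copn: "coprime n d"
  proof (rule coprimeI)
    fix c assume "c dvd n" "c dvd d"
    moreover from this have "c dvd n + 1" unfolding m [symmetric] by simp
    ultimately show "c dvd 1" by (metis dvd_add_right_iff)
  qed
  define Q where "Q = qvar ^ d"
  define D where "D = qfac Q Q (n - 1)"
  \<comment> \<open>The complement of (Q;Q)_k in the common denominator (Q;Q)_(n-1): its factors
    start at 1 - Q^(k+1). With it the sum becomes the quotient of the polynomials \<open>A\<close>
    and \<open>B\<close>.\<close>
  define R where "R k = qfac (Q * Q ^ k) Q (n - 1 - k)" for k
  define E where "E k = d * (d - 3) * k div 2" for k
  define A where "A = (\<Sum>k<n. (1 - qvar ^ (2*d*k + 1)) * (qfac qvar Q k * R k) ^ d * qvar ^ E k)"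
  define B where "B = (1 - qvar) * D ^ d"
  have [simp]: "poly qvar y = y" for y by (simp add: qvar_def)
  have DR: "D = qfac Q Q k * R k" if "k < n" for k
    unfolding D_def R_def using that by (simp flip: qfac_add)
  have polyD: "poly D y = qfac (y ^ d) (y ^ d) (n - 1)" for y
    by (simp add: D_def poly_qfac_eq Q_def)
  have polyA: "poly A y = poly D y ^ d * vwp_sum d n y" if "poly D y \<noteq> 0" for y
  proof -
    have "poly ((1 - qvar ^ (2*d*k + 1)) * (qfac qvar Q k * R k) ^ d * qvar ^ E k) y
      = poly D y ^ d * ((1 - y * (y ^ d) ^ (2 * k)) * (qfac y (y ^ d) k ^ d / qfac (y ^ d) (y ^ d) k ^ d) * y ^ E k)"
      if k: "k < n" for k
    proof -
      have D: "poly D y = qfac (y ^ d) (y ^ d) k * poly (R k) y"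
        using arg_cong[OF DR[OF k], of "\<lambda>p. poly p y"] by (simp add: poly_qfac_eq Q_def)
      then have "qfac (y ^ d) (y ^ d) k \<noteq> 0" using \<open>poly D y \<noteq> 0\<close> by auto
      moreover have "y ^ (2*d*k + 1) = y * (y ^ d) ^ (2 * k)"
        by (simp add: mult_ac flip: power_mult)
      ultimately show ?thesis
        by (simp add: D poly_qfac_eq Q_def power_mult_distrib)
    qed
    then show ?thesis
      by (simp add: A_def vwp_sum_def poly_sum sum_distrib_left E_def)
  qed
  \<comment> \<open>Stated for a general order \<open>r\<close> to cover both r = n and r = M: a
    zero of \<open>D\<close> would make \<open>r\<close> divide a positive integer below
    \<open>n\<close>.\<close>
  have root: "poly D x \<noteq> 0 \<and> poly B x \<noteq> 0"
    if x: "\<And>j. x ^ j = 1 \<longleftrightarrow> r dvd j" and r: "coprime r d" "r \<ge> n" for x r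
  proof -
    have "(x ^ d) * (x ^ d) ^ i \<noteq> 1" if "i < n - 1" for i
    proof
      assume "(x ^ d) * (x ^ d) ^ i = 1"
      then have "x ^ (d * Suc i) = 1" by (simp only: power_mult power_Suc)
      then have "r dvd d * Suc i" unfolding x .
      then have "r dvd Suc i" using r(1) by (simp add: coprime_dvd_mult_right_iff del: mult_Suc_right)
      then show False using that r(2) by (auto dest: dvd_imp_le)
    qed
    then have "poly D x \<noteq> 0" by (auto simp: polyD qfac_eq_0_iff)
    moreover have "x \<noteq> 1" using x[of 1] r(2) \<open>n \<ge> 3\<close> by auto
    ultimately show ?thesis by (simp add: B_def)
  qed
  have rootn: "poly D x \<noteq> 0 \<and> poly B x \<noteq> 0" if "x \<in> primitive_roots n" for x
    using root[OF primitive_roots_power_eq_1_iff[OF that \<open>n > 0\<close>] copn] by simp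
  have "M > 0" using M \<open>n > 0\<close> by simp
  have rootM: "poly D x \<noteq> 0 \<and> poly B x \<noteq> 0" if "x \<in> primitive_roots M" for x
    using root[OF primitive_roots_power_eq_1_iff[OF that \<open>M > 0\<close>] copM] M by simp
  have cop: "coprime B ((cyclotomic n)\<^sup>2 * cyclotomic M)"
    unfolding cyclotomic_eq_prod[OF \<open>n > 0\<close>] cyclotomic_eq_prod[OF \<open>M > 0\<close>]
    using rootn rootM
    by (auto simp: coprime_mult_right_iff intro!: prod_coprime_right coprime_linear)
  have dvdn: "[:- x, 1:]\<^sup>2 dvd A" if "x \<in> primitive_roots n" for x
  proof (rule linear_square_dvd)
    note D = rootn[OF that, THEN conjunct1]
    note vwp = vwp_sum_double_zero[OF assms(1) m primitive_roots_power_eq_1_iff[OF that \<open>n > 0\<close>]]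
    show "poly A x = 0" using polyA[OF D] vwp by simp
    have "((\<lambda>y. poly D y ^ d * vwp_sum d n y) has_field_derivative 0) (at x)"
      by (rule DERIV_cong[OF DERIV_mult[OF DERIV_power[OF poly_DERIV] vwp[THEN conjunct2]]]) (simp add: vwp)
    \<comment> \<open>\<open>polyA\<close> holds only where \<open>D\<close> is nonzero, which is
      enough to compare derivatives at \<open>x\<close>.\<close>
    moreover have "\<forall>\<^sub>F y in nhds x. poly A y = poly D y ^ d * vwp_sum d n y"
      using eventually_nonzero_nhds[where f = "poly D" and c = 0, OF _ D] by (rule eventually_mono) (simp_all add: polyA)
    ultimately have "(poly A has_field_derivative 0) (at x)"
      by (subst DERIV_cong_ev[OF refl _ refl])
    then show "poly (pderiv A) x = 0"
      using poly_DERIV DERIV_unique by blast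
  qed
  have dvdM: "[:- x, 1:] dvd A" if "x \<in> primitive_roots M" for x
  proof -
    note D = rootM[OF that, THEN conjunct1]
    have "vwp_sum d n x = 0"
      using sum_eq_0_at_primitive_root[OF assms(1) m primitive_roots_power_eq_1_iff[OF that \<open>M > 0\<close>, unfolded M_def] D[unfolded polyD]]
      by (simp add: vwp_sum_def power_divide)
    then show ?thesis using polyA[OF D] by (simp add: poly_eq_0_iff_dvd)
  qed
  \<comment> \<open>A common root would have both orders, but M \<ge> 3n exceeds \<open>n\<close>.
    Disjointness lets the prescribed multiplicities 2 and 1 be combined in one product.\<close>
  have disj: "primitive_roots n \<inter> primitive_roots M = {}"
  proof -
    have False if "x \<in> primitive_roots n" "x \<in> primitive_roots M" for x
    proof -
      have "M dvd n"
        using primitive_roots_power_eq_1_iff[OF that(1) \<open>n > 0\<close>, of n]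
          primitive_roots_power_eq_1_iff[OF that(2) \<open>M > 0\<close>, of n] by simp
      then show False using M \<open>n > 0\<close> by (auto dest: dvd_imp_le)
    qed
    then show ?thesis by blast
  qed
  define mult where "mult x = (if x \<in> primitive_roots n then 2 else 1 :: nat)" for x
  have "(\<Prod>x\<in>primitive_roots n \<union> primitive_roots M. [:- x, 1:] ^ mult x) dvd A"
    using dvdn dvdM by (intro prod_linear_power_dvd) (auto simp: mult_def finite_primitive_roots)
  also have "(\<Prod>x\<in>primitive_roots n \<union> primitive_roots M. [:- x, 1:] ^ mult x)
      = (\<Prod>x\<in>primitive_roots n. [:- x, 1:] ^ mult x) * (\<Prod>x\<in>primitive_roots M. [:- x, 1:] ^ mult x)"
    using disj by (intro prod.union_disjoint finite_primitive_roots)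
  also have "(\<Prod>x\<in>primitive_roots n. [:- x, 1:] ^ mult x) = (cyclotomic n)\<^sup>2"
    by (simp add: cyclotomic_eq_prod[OF \<open>n > 0\<close>] mult_def prod_power_distrib)
  also have "(\<Prod>x\<in>primitive_roots M. [:- x, 1:] ^ mult x) = cyclotomic M"
    unfolding cyclotomic_eq_prod[OF \<open>M > 0\<close>]
    using disj by (intro prod.cong) (auto simp: mult_def)
  finally have dvd: "(cyclotomic n)\<^sup>2 * cyclotomic M dvd A" .
  \<comment> \<open>Every factor of \<open>D\<close> has value 1 at 0.\<close>
  have "poly D 0 \<noteq> 0" using assms(1) by (auto simp: polyD qfac_eq_0_iff zero_power)
  then have "D \<noteq> 0" by auto
  have "1 - qvar \<noteq> 0" by (simp add: qvar_def one_pCons)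
  then have "B \<noteq> 0" using \<open>D \<noteq> 0\<close> by (simp add: B_def)
  have summand: "qint (2*d*k + 1) * rf (qpoch qvar (qvar ^ d) k) ^ d / rf (qpoch (qvar ^ d) (qvar ^ d) k) ^ d
        * rf (qvar ^ (d * (d - 3) * k div 2))
      = rf ((1 - qvar ^ (2*d*k + 1)) * (qfac qvar Q k * R k) ^ d * qvar ^ E k) / rf B" if "k < n" for k
  proof -
    have "rf (qfac Q Q k) \<noteq> 0" "rf (R k) \<noteq> 0" "rf (1 - qvar) \<noteq> 0"
      using DR[OF that] \<open>D \<noteq> 0\<close> \<open>1 - qvar \<noteq> 0\<close> by (auto simp: rf_simps)
    then show ?thesis
      unfolding B_def DR[OF that] qint_def Fract_eq_rf_divide
      by (simp add: rf_simps rf_power qpoch_eq_qfac power_mult_distrib flip: Q_def E_def)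
  qed
  have "(\<Sum>k<n. qint (2*d*k + 1) * rf (qpoch qvar (qvar ^ d) k) ^ d / rf (qpoch (qvar ^ d) (qvar ^ d) k) ^ d
        * rf (qvar ^ (d * (d - 3) * k div 2))) = Fract A B"
    unfolding Fract_eq_rf_divide A_def rf_sum sum_divide_distrib using summand by (intro sum.cong) auto
  then show ?thesis
    unfolding rf_cong_def M_def [symmetric] using \<open>B \<noteq> 0\<close> cop dvd by (intro exI[of _ A] exI[of _ B]) simp
qed

end
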